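(* Let $PR$ be the class of all finitely additive probabilities $\mu$ on the power set of $\mathbb{Z}$ such that $\mu(\{z\in\mathbb{Z}: z\equiv j \pmod p\})=1/p$ for every prime $p$ and every integer $j$, and let $\mathbb{N}_p\subset\mathbb{Z}$ be the set of prime numbers. Then $$\{\mu(\mathbb{N}_p):\mu\in PR\}=[0,1/2].$$
   Context: A finitely additive probability (probability charge) on the power set of $\mathbb{Z}$ is a function $\mu:2^{\mathbb{Z}}\to[0,\infty)$ with $\mu(\mathbb{Z})=1$ and $\mu(A\cup B)=\mu(A)+\mu(B)$ for all disjoint $A,B\subseteq\mathbb{Z}$. Prime numbers are positive ($2,3,5,\dots$). *)

theory Defs
  imports Complex_Main "HOL-Number_Theory.Cong" "HOL-Computational_Algebra.Primes"
begin

definition probability_charge :: "('a set \<Rightarrow> real) \<Rightarrow> bool" where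
  "probability_charge \<mu> \<longleftrightarrow>
     (\<forall>A. 0 \<le> \<mu> A) \<and> \<mu> UNIV = 1 \<and>
     (\<forall>A B. A \<inter> B = {} \<longrightarrow> \<mu> (A \<union> B) = \<mu> A + \<mu> B)"

text \<open>On type \<^typ>\<open>int\<close>, \<^const>\<open>prime\<close> holds of positive numbers only.\<close>

definition PR :: "(int set \<Rightarrow> real) set" where
  "PR = {\<mu>. probability_charge \<mu> \<and>
     (\<forall>p j :: int. prime p \<longrightarrow> \<mu> {z. [z = j] (mod p)} = 1 / of_int p)}"

definition primes_int :: "int set" where
  "primes_int = {p. prime p}"

end

theory Submission
  imports Defs "HOL-Probability.Probability" "HOL-Number_Theory.Number_Theory"
    "HOL-Computational_Algebra.Squarefree" "HOL-Real_Asymp.Real_Asymp"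
begin

text \<open>
  Upper bound: points have mass at most \<open>1/p\<close> for every prime \<open>p\<close>, hence mass \<open>0\<close>, and all
  primes except \<open>2\<close> lie in the class \<open>1 mod 2\<close>, which has mass \<open>1/2\<close>.

  For the other inclusion, \<open>PR\<close> is convex, so only the values \<open>0\<close> and \<open>1/2\<close> have to be attained.
  Charges are obtained as cluster points of sequences of probabilities, which exist because the
  cube of all functions from sets to \<open>[0,1]\<close> is compact. For the value \<open>0\<close> one
  takes probabilities on the \<^emph>\<open>negative\<close> integers that are uniform modulo each of the first few
  primes; the Chinese remainder theorem provides them.

  For the value \<open>1/2\<close>, one half of the mass is put on the primes up to \<open>X\<close>, with weights
  proportional to \<open>ln q / q\<close>. In the limit \<open>X \<rightarrow> \<infinity>\<close> this is, modulo every prime \<open>p\<close>, uniform on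
  the \<open>p - 1\<close> nonzero classes. The other half is put on negative integers whose residue modulo
  \<open>p\<close> has probability \<open>2/p\<close> at \<open>0\<close> and \<open>(p-2)/(p(p-1))\<close> at every other class; this
  compensates exactly, since the average of the two laws is uniform. As \<open>PR\<close> constrains each prime
  separately, no joint law has to be controlled beyond what the Chinese remainder theorem gives.

  The substance is thus the equidistribution of the primes in the nonzero classes modulo a prime
  (lemma \<open>prime_weight_equidistributed\<close>), a form of Dirichlet's theorem. An
  upper bound sieve would not suffice here: the conditional law on the primes may give no class
  more than \<open>2/p\<close>, whereas sieves yield \<open>2/(p-1)\<close>, and excluding that the primes favour, say, the
  quadratic residues is the nonvanishing of \<open>L(1, \<xi>)\<close>. The proof given here is elementary, in the style of Mertens and
  Shapiro. With \<open>\<Lambda>\<close> the von Mangoldt function and \<open>S(N) = \<Sum>n\<le>N. \<xi>(n) \<Lambda>(n) / n\<close>, one shows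
  for nonprincipal \<open>\<xi>\<close>:

  \<^item> \<open>S\<close> is bounded if \<open>L(1, \<xi>) \<noteq> 0\<close> (from \<open>\<Lambda> * 1 = ln\<close>), and
    \<open>S(N) = - ln N + O(1)\<close> if \<open>L(1, \<xi>) = 0\<close> (by Moebius inversion);
  \<^item> summing over all characters counts \<open>n \<equiv> 1\<close> with nonnegative weights, while the principal
    character contributes at most \<open>ln N + O(1)\<close>; so at most one \<open>L(1, \<xi>)\<close> vanishes, and because
    zeros come in conjugate pairs, such a \<open>\<xi>\<close> is real;
  \<^item> for real \<open>\<xi>\<close>, the divisor sums \<open>r = 1 * \<xi>\<close> are nonnegative and at least \<open>1\<close> at squares, so
    \<open>\<Sum> r(n) / sqrt n\<close> diverges, which contradicts \<open>L(1, \<xi>) = 0\<close>.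
\<close>

section \<open>Summation by parts and sums over divisors\<close>

lemma divide_less_div_plus_1:
  assumes "d > 0"
  shows "real n / real d < real (n div d) + 1"
proof -
  have "real (n mod d) / real d < 1" using assms by simp
  then show ?thesis by (simp add: of_nat_of_nat_div_aux[of n d])
qed

text \<open>
  Abel summation: weights that decrease to a nonnegative value do not destroy the cancellation in
  an oscillating sum. Every later estimate of a character sum rests on this bound.
\<close>

lemma norm_sum_mult_antimono_le:
  fixes a :: "nat \<Rightarrow> complex" and f :: "nat \<Rightarrow> real"
  assumes bd: "\<And>k. norm (\<Sum>n=m..k. a n) \<le> D"
    and f0: "\<And>n. n \<in> {m..M} \<Longrightarrow> f n \<ge> 0"
    and mono: "\<And>n. m \<le> n \<Longrightarrow> n < M \<Longrightarrow> f (Suc n) \<le> f n"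
    and le: "m \<le> M"
  shows "norm (\<Sum>n=m..M. a n * of_real (f n)) \<le> D * f m"
proof -
  let ?A = "\<lambda>k. \<Sum>n=m..k. a n"
  have id: "(\<Sum>n=m..k. a n * of_real (f n)) =
      (\<Sum>n=m..<k. ?A n * of_real (f n - f (Suc n))) + ?A k * of_real (f k)" if "m \<le> k" for k
    using that
  proof (induction k rule: dec_induct)
    case base
    then show ?case by simp
  next
    case (step k)
    then show ?case by (simp add: algebra_simps)
  qed
  have "norm (\<Sum>n=m..M. a n * of_real (f n))
      \<le> (\<Sum>n=m..<M. norm (?A n * of_real (f n - f (Suc n)))) + norm (?A M * of_real (f M))"
    unfolding id[OF le] by (intro order.trans[OF norm_triangle_ineq] add_mono norm_sum order.refl)
  also have "\<dots> \<le> (\<Sum>n=m..<M. D * (f n - f (Suc n))) + D * f M"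
  proof (intro add_mono sum_mono)
    fix n assume "n \<in> {m..<M}"
    then show "norm (?A n * of_real (f n - f (Suc n))) \<le> D * (f n - f (Suc n))"
      unfolding norm_mult norm_of_real using mono[of n] by (auto intro!: mult_right_mono bd)
  next
    show "norm (?A M * of_real (f M)) \<le> D * f M"
      using f0[of M] le by (auto simp: norm_mult intro!: mult_right_mono bd)
  qed
  also have "(\<Sum>n=m..<M. D * (f n - f (Suc n))) = D * (f m - f M)"
    using sum_Suc_diff'[OF le, of "\<lambda>n. - f n"] by (simp flip: sum_distrib_left)
  finally show ?thesis by (simp add: algebra_simps)
qed

text \<open>
  Both sides sum over the lattice points \<open>d m \<le> N\<close>: this is the finite form of the product of
  two Dirichlet series.
\<close>

lemma sum_divisors_eq_sum_multiples:
  fixes g :: "nat \<Rightarrow> nat \<Rightarrow> 'a :: comm_monoid_add"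
  shows "(\<Sum>n=1..N. \<Sum>d | d dvd n. g d (n div d)) = (\<Sum>d=1..N. \<Sum>m=1..N div d. g d m)"
proof -
  have "(\<Sum>n=1..N. \<Sum>d | d dvd n. g d (n div d)) =
        (\<Sum>(n,d)\<in>(SIGMA n:{1..N}. {d. d dvd n}). g d (n div d))"
    by (subst sum.Sigma) (auto intro: finite_divisors_nat)
  also have "\<dots> = (\<Sum>(d,m)\<in>(SIGMA d:{1..N}. {1..N div d}). g d m)"
  proof (rule sum.reindex_bij_witness[of _ "\<lambda>(d,m). (d * m, d)" "\<lambda>(n,d). (d, n div d)"])
    fix x assume "x \<in> (SIGMA n:{1..N}. {d. d dvd n})"
    then obtain d k where x: "x = (d * k, d)" "d > 0" "k > 0" "d * k \<le> N"
      by (auto elim!: dvdE)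
    have "d * 1 \<le> d * k" using x by (intro mult_left_mono) auto
    then have "d \<le> N" using x by linarith
    with x show "(case x of (n, d) \<Rightarrow> (d, n div d)) \<in> (SIGMA d:{1..N}. {1..N div d})"
      by (auto simp: less_eq_div_iff_mult_less_eq mult.commute)
  qed (auto simp: less_eq_div_iff_mult_less_eq mult.commute)
  also have "\<dots> = (\<Sum>d=1..N. \<Sum>m=1..N div d. g d m)"
    by (subst sum.Sigma) auto
  finally show ?thesis .
qed

section \<open>Estimates of Chebyshev and Mertens for the von Mangoldt function\<close>

lemma ln_fact_eq_sum_ln: "ln (fact N :: real) = (\<Sum>n=1..N. ln (real n))"
  by (induction N) (auto simp: ln_mult)

lemma ln_fact_eq_sum_mangoldt:
  "ln (fact N) = (\<Sum>d=1..N. mangoldt d * real (N div d))"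
proof -
  have "ln (fact N :: real) = (\<Sum>n=1..N. ln (real n))"
    by (rule ln_fact_eq_sum_ln)
  also have "\<dots> = (\<Sum>n=1..N. \<Sum>d | d dvd n. mangoldt d)"
    by (intro sum.cong refl) (simp add: mangoldt_sum)
  also have "\<dots> = (\<Sum>d=1..N. mangoldt d * real (N div d))"
    by (subst sum_divisors_eq_sum_multiples) (simp add: mult.commute)
  finally show ?thesis .
qed

text \<open>
  Chebyshev's argument: the primes in \<open>(n, 2n]\<close> divide the central binomial coefficient, which is
  at most \<open>4 ^ n\<close>.
\<close>

lemma sum_mangoldt_dyadic_le: "(\<Sum>d=Suc n..2*n. mangoldt d) \<le> 2 * real n"
proof -
  have "(\<Sum>d=Suc n..2*n. mangoldt d) 
       \<le> (\<Sum>d=1..2*n. mangoldt d * (real (2 * n div d) - 2 * real (n div d)))"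
  proof (rule sum_le_included[where i = id])
    have "2 * (n div d) \<le> 2 * n div d" for d
    proof (cases "d = 0")
      case False
      have "2 * (n div d) * d \<le> 2 * n"
        using mult_left_mono[OF div_times_less_eq_dividend[of n d], of 2] by (simp only: mult.assoc)
      then show ?thesis using False by (subst less_eq_div_iff_mult_less_eq) auto
    qed simp
    from of_nat_mono[OF this] have *: "2 * real (n div d) \<le> real (2 * n div d)" for d
      by simp
    show "\<forall>d\<in>{1..2*n}. 0 \<le> mangoldt d * (real (2 * n div d) - 2 * real (n div d))"
      using * by (intro ballI mult_nonneg_nonneg mangoldt_nonneg) (simp add: mangoldt_nonneg)
    show "\<forall>d\<in>{Suc n..2*n}. \<exists>y\<in>{1..2*n}. id y = d \<and>
        mangoldt d \<le> mangoldt y * (real (2 * n div y) - 2 * real (n div y))"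
    proof
      fix d assume d: "d \<in> {Suc n..2*n}"
      then have "2 * n div d = 1" by (intro div_nat_eqI) auto
      moreover have "n div d = 0" using d by simp
      ultimately show "\<exists>y\<in>{1..2*n}. id y = d \<and>
        mangoldt d \<le> mangoldt y * (real (2 * n div y) - 2 * real (n div y))"
        using d by (intro bexI[of _ d]) auto
    qed
  qed auto
  also have "\<dots> = ln (fact (2*n)) - 2 * (\<Sum>d=1..2*n. mangoldt d * real (n div d))"
    unfolding ln_fact_eq_sum_mangoldt by (simp add: algebra_simps sum_subtractf sum_distrib_left)
  also have "\<dots> = ln (fact (2*n)) - 2 * ln (fact n)"
  proof -
    have "(\<Sum>d=1..2*n. mangoldt d * real (n div d)) = (\<Sum>d=1..n. mangoldt d * real (n div d))"
      by (rule sum.mono_neutral_right) auto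
    then show ?thesis by (simp add: ln_fact_eq_sum_mangoldt)
  qed
  also have "\<dots> = ln (real ((2*n) choose n))"
  proof -
    have "real ((2*n) choose n) = fact (2*n) / (fact n * fact n)"
      by (subst binomial_fact) auto
    also have "ln \<dots> = ln (fact (2*n)) - 2 * ln (fact n)"
      by (subst ln_div) (auto simp: ln_mult)
    finally show ?thesis by simp
  qed
  also have "\<dots> \<le> ln (2 ^ (2 * n))"
  proof (subst ln_le_cancel_iff)
    have "real (2 * n choose n) \<le> real (2 ^ (2 * n))"
      by (intro of_nat_mono binomial_le_pow2)
    then show "real (2 * n choose n) \<le> 2 ^ (2 * n)" by simp
  qed auto
  also have "\<dots> = 2 * real n * ln 2" by (simp add: ln_realpow)
  also have "\<dots> \<le> 2 * real n * 1"
    using ln_2_less_1 by (intro mult_left_mono) auto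
  finally show ?thesis by simp
qed

lemma sum_mangoldt_le: "(\<Sum>d=1..N. mangoldt d) \<le> 4 * real N"
proof (induction N rule: less_induct)
  case (less N)
  show ?case
  proof (cases "N = 0")
    case False
    define n where "n = N div 2"
    have split: "(\<Sum>d=1..2*n. mangoldt d) = (\<Sum>d=1..n. mangoldt d) + (\<Sum>d=Suc n..2*n. (mangoldt d :: real))"
      by (subst sum.union_disjoint[symmetric]) (auto intro!: sum.cong)
    have 1: "(\<Sum>d=1..2*n. mangoldt d) \<le> 6 * real n"
      using split less[of n] sum_mangoldt_dyadic_le[of n] False by (simp add: n_def)
    show ?thesis
    proof (cases "even N")
      case True
      then show ?thesis using 1 by (auto simp: n_def)
    next
      case False
      then have N: "N = Suc (2 * n)" by (auto simp: n_def elim: oddE)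
      have "mangoldt N \<le> ln (real N)" by (rule mangoldt_le) (simp add: N)
      also have "\<dots> \<le> real N - 1" by (rule ln_le_minus_one) (simp add: N)
      finally show ?thesis using 1 by (simp add: N)
    qed
  qed auto
qed

lemma ln_fact_bounds:
  assumes "N > 0"
  shows "ln (fact N) \<le> real N * ln (real N)" "ln (fact N) \<ge> real N * ln (real N) - real N"
proof -
  have "ln (fact N :: real) \<le> ln (real N ^ N)"
    using assms fact_le_power[of N] by (subst ln_le_cancel_iff) (auto )
  then show "ln (fact N) \<le> real N * ln (real N)"
    using assms by (simp add: ln_realpow)
  have sm: "summable (\<lambda>k. real N ^ k /\<^sub>R fact k)" by (rule summable_exp_generic)
  have "real N ^ N / fact N \<le> (\<Sum>k. (real N) ^ k /\<^sub>R fact k)"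
    using Series.sum_le_suminf[OF sm, of "{N}"] by (simp add: divide_inverse mult.commute)
  then have "real N ^ N / fact N \<le> exp (real N)"
    by (simp add: exp_def)
  then have "ln (real N ^ N / fact N) \<le> ln (exp (real N))"
    using assms by (subst ln_le_cancel_iff) auto
  then show "ln (fact N) \<ge> real N * ln (real N) - real N"
    using assms by (simp add: ln_div ln_realpow)
qed

text \<open>
  Replacing \<open>N div d\<close> by \<open>N / d\<close> in the formula for \<open>ln (fact N)\<close> costs at most
  \<open>\<Sum>d\<le>N. \<Lambda>(d)\<close>, which is \<open>O(N)\<close> by Chebyshev's bound.
\<close>

lemma sum_mangoldt_over_bounds:
  assumes "N > 0"
  shows "(\<Sum>d=1..N. mangoldt d / real d) \<le> ln (real N) + 4"
    and "(\<Sum>d=1..N. mangoldt d / real d) \<ge> ln (real N) - 1"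
proof -
  let ?W = "\<Sum>d=1..N. mangoldt d / real d"
  have "ln (fact N) \<le> (\<Sum>d=1..N. mangoldt d * (real N / real d))"
    unfolding ln_fact_eq_sum_mangoldt
    by (intro sum_mono mult_left_mono mangoldt_nonneg) (auto simp: of_nat_div_le_of_nat)
  also have "\<dots> = real N * ?W" by (simp add: sum_distrib_left mult_ac)
  finally have "real N * (ln (real N) - 1) \<le> real N * ?W"
    using ln_fact_bounds(2)[OF assms] by (simp add: algebra_simps)
  then show "?W \<ge> ln (real N) - 1" using assms by simp
  have "real N * ?W - (\<Sum>d=1..N. mangoldt d) = (\<Sum>d=1..N. mangoldt d * (real N / real d - 1))"
    by (simp add: sum_distrib_left sum_subtractf algebra_simps)
  also have "\<dots> \<le> ln (fact N)"
    unfolding ln_fact_eq_sum_mangoldt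
  proof (intro sum_mono mult_left_mono mangoldt_nonneg)
    fix d assume "d \<in> {1..N}"
    then show "real N / real d - 1 \<le> real (N div d)"
      using divide_less_div_plus_1[of d N] by simp
  qed
  finally have "real N * ?W \<le> real N * (ln (real N) + 4)"
    using ln_fact_bounds(1)[OF assms] sum_mangoldt_le[of N] by (simp add: algebra_simps)
  then show "?W \<le> ln (real N) + 4" using assms by simp
qed

section \<open>The Moebius function\<close>

definition moebius :: "nat \<Rightarrow> real" where
  "moebius n = (if squarefree n then (-1) ^ card (prime_factors n) else 0)"

lemma abs_moebius_le: "\<bar>moebius n\<bar> \<le> 1"
  by (simp add: moebius_def)

lemma moebius_1 [simp]: "moebius (Suc 0) = 1"
  by (simp add: moebius_def)

text \<open>
  The sign change behind all cancellation: multiplying by a new prime factor pairs the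
  divisors with and without that prime.
\<close>

lemma moebius_prime_mult:
  assumes "prime q" "\<not> q dvd d"
  shows "moebius (q * d) = - moebius d"
proof -
  have cop: "coprime q d" using assms by (simp add: prime_imp_coprime)
  have d: "d \<noteq> 0" using assms(2) by (metis dvd_0_right)
  have "squarefree (q * d) \<longleftrightarrow> squarefree d"
    using squarefree_mult_coprime[OF cop squarefree_prime[OF assms(1)]] squarefree_multD(2) by blast
  moreover have "prime_factors (q * d) = insert q (prime_factors d)"
    using assms(1) d by (subst prime_factors_product) (auto simp: prime_prime_factors)
  moreover have "q \<notin> prime_factors d" using assms(2) by (metis in_prime_factors_imp_dvd)
  ultimately show ?thesis by (simp add: moebius_def)
qed

lemma sum_moebius_divisors:
  assumes "n > 0"
  shows "(\<Sum>d | d dvd n. moebius d) = (if n = 1 then 1 else 0)"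
proof (cases "n = 1")
  case True
  then show ?thesis by (simp add: moebius_def)
next
  case False
  then obtain q where q: "prime q" "q dvd n" using prime_factor_nat by blast
  let ?A = "{d. d dvd n \<and> \<not> q dvd d}"
  have fin: "finite {d. d dvd n}" using assms by (simp add: finite_divisors_nat)
  have "(\<Sum>d | d dvd n \<and> q dvd d. moebius d) = (\<Sum>d\<in>(*) q ` ?A. moebius d)"
  proof (rule sum.mono_neutral_right)
    show "finite {d. d dvd n \<and> q dvd d}" by (rule finite_subset[OF _ fin]) auto
    show "(*) q ` ?A \<subseteq> {d. d dvd n \<and> q dvd d}"
    proof clarify
      fix d assume "d dvd n" "\<not> q dvd d"
      then show "q * d dvd n \<and> q dvd q * d"
        using q by (simp add: divides_mult prime_imp_coprime)
    qed
    show "\<forall>d\<in>{d. d dvd n \<and> q dvd d} - (*) q ` ?A. moebius d = 0"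
    proof
      fix d assume d: "d \<in> {d. d dvd n \<and> q dvd d} - (*) q ` ?A"
      then obtain e where e: "d = q * e" by (auto elim: dvdE)
      have "e dvd n" using d e by (auto intro: dvd_mult_right)
      with d have "q dvd e" by (auto simp: e)
      then have "q ^ 2 dvd d" by (simp add: e power2_eq_square)
      then have "\<not> squarefree d" using q(1) by (intro not_squarefreeI[of q]) auto
      then show "moebius d = 0" by (simp add: moebius_def)
    qed
  qed
  also have "\<dots> = (\<Sum>d\<in>?A. moebius (q * d))"
    using q(1) by (subst sum.reindex) (auto simp: inj_on_def)
  also have "\<dots> = - (\<Sum>d\<in>?A. moebius d)"
    unfolding sum_negf[symmetric] by (rule sum.cong) (auto simp: moebius_prime_mult[OF q(1)])
  finally have "(\<Sum>d | d dvd n \<and> q dvd d. moebius d) + (\<Sum>d\<in>?A. moebius d) = 0" by simp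
  moreover have "(\<Sum>d | d dvd n. moebius d) = 
      (\<Sum>d | d dvd n \<and> q dvd d. moebius d) + (\<Sum>d\<in>?A. moebius d)"
    by (subst sum.union_disjoint[symmetric]) (auto intro!: sum.cong finite_subset[OF _ fin])
  ultimately show ?thesis using False by simp
qed

text \<open>
  Moebius inversion of \<open>ln = \<Lambda> * 1\<close> gives \<open>\<Lambda>(n) = \<Sum>d|n. \<mu>(d) (ln n - ln d)\<close>, where the part with
  \<open>ln n\<close> vanishes.
\<close>

lemma sum_moebius_ln_divisors:
  assumes "n > 0"
  shows "(\<Sum>d | d dvd n. moebius d * ln (real d)) = - mangoldt n"
proof -
  have fin: "finite {d. d dvd n}" using assms by (simp add: finite_divisors_nat)
  have pos: "d > 0" if "d dvd n" for d using that assms by (auto intro: Nat.gr0I)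
  have quot: "n div d > 0" if "d dvd n" for d
    using that assms by (auto elim!: dvdE)
  then have fin': "finite {e. e dvd n div d}" if "d dvd n" for d
    using that by (simp add: finite_divisors_nat)
  have swap: "e dvd n \<and> d dvd n div e" if "d dvd n" "e dvd n div d" for d e
    using that assms by (auto elim!: dvdE)
  have "(\<Sum>d | d dvd n. moebius d * ln (real (n div d)))
       = (\<Sum>d | d dvd n. \<Sum>e | e dvd n div d. moebius d * mangoldt e)"
    using quot by (intro sum.cong refl) (simp add: mangoldt_sum flip: sum_distrib_left)
  also have "\<dots> = (\<Sum>(d,e)\<in>(SIGMA d:{d. d dvd n}. {e. e dvd n div d}). moebius d * mangoldt e)"
    by (subst sum.Sigma) (auto simp: fin fin')
  also have "\<dots> = (\<Sum>(e,d)\<in>(SIGMA e:{e. e dvd n}. {d. d dvd n div e}). moebius d * mangoldt e)"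
    by (rule sum.reindex_bij_witness[of _ "\<lambda>(e,d). (d,e)" "\<lambda>(d,e). (e,d)"])
      (auto dest: swap)
  also have "\<dots> = (\<Sum>e | e dvd n. \<Sum>d | d dvd n div e. moebius d * mangoldt e)"
    by (subst sum.Sigma) (auto simp: fin fin')
  also have "\<dots> = (\<Sum>e | e dvd n. if n div e = 1 then mangoldt e else 0)"
    using quot by (intro sum.cong refl) (simp add: sum_moebius_divisors flip: sum_distrib_right)
  also have "\<dots> = (\<Sum>e\<in>{n}. mangoldt e)"
    using assms by (intro sum.mono_neutral_cong_right fin) (auto dest: dvd_div_mult_self)
  finally have "(\<Sum>d | d dvd n. moebius d * ln (real (n div d))) = mangoldt n" by simp
  moreover have "(\<Sum>d | d dvd n. moebius d * ln (real (n div d)))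
      = (\<Sum>d | d dvd n. moebius d * ln (real n) - moebius d * ln (real d))"
    using assms pos by (intro sum.cong refl) (simp add: real_of_nat_div ln_div right_diff_distrib)
  moreover have "(\<Sum>d | d dvd n. moebius d * ln (real n)) = 0"
    using sum_moebius_divisors[OF assms] by (simp flip: sum_distrib_right)
  ultimately show ?thesis by (simp add: sum_subtractf)
qed

section \<open>Completely multiplicative functions with bounded sums\<close>

text \<open>
  These are the only properties of a nonprincipal Dirichlet character that the estimates use.
  Inside the locale, \<open>L\<close> is the value at \<open>1\<close> of the attached \<open>L\<close>-series, \<open>F\<close> its partial sums, and
  \<open>S\<close> the partial sums of the series of \<open>\<xi>(n) \<Lambda>(n) / n\<close>.
\<close>

locale oscillating_multiplicative =
  fixes \<xi> :: "nat \<Rightarrow> complex" and D :: real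
  assumes mult: "\<xi> (m * n) = \<xi> m * \<xi> n"
    and one: "\<xi> 1 = 1"
    and unimodular: "\<xi> n = 0 \<or> norm (\<xi> n) = 1"
    and bound: "norm (\<Sum>n=a..b. \<xi> n) \<le> D"
begin

lemma norm_le_1: "norm (\<xi> n) \<le> 1"
  using unimodular[of n] by auto

lemma D_ge_1: "D \<ge> 1"
  using bound[of 1 1] one by simp

definition F :: "nat \<Rightarrow> complex" where "F N = (\<Sum>n=1..N. \<xi> n / of_nat n)"

definition L :: complex where "L = lim F"

definition S :: "nat \<Rightarrow> complex" where "S N = (\<Sum>n=1..N. \<xi> n * mangoldt n / of_nat n)"

lemma norm_F_diff_le:
  assumes "N \<le> M"
  shows "norm (F M - F N) \<le> D / (real N + 1)"
proof (cases "N = M")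
  case False
  have "F M = F N + (\<Sum>n=Suc N..M. \<xi> n / of_nat n)"
    unfolding F_def using assms by (subst sum.union_disjoint[symmetric]) (auto intro!: sum.cong)
  then have "F M - F N = (\<Sum>n=Suc N..M. \<xi> n * of_real (1 / real n))"
    by simp
  also have "norm \<dots> \<le> D * (1 / real (Suc N))"
    using assms False by (intro norm_sum_mult_antimono_le bound) (auto simp: frac_le)
  finally show ?thesis by (simp add: add.commute)
qed (use D_ge_1 in auto)

lemma F_tendsto: "F \<longlonglongrightarrow> L"
proof -
  have "Cauchy F"
  proof (rule CauchyI)
    fix e :: real assume e: "e > 0"
    obtain K :: nat where K: "real K > 2 * D / e" using reals_Archimedean2 by blast
    have *: "norm (F m - F K) < e / 2" if "m \<ge> K" for m
    proof -
      have "norm (F m - F K) \<le> D / (real K + 1)" using that by (rule norm_F_diff_le)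
      also have "\<dots> < e / 2" using K e by (simp add: field_simps)
      finally show ?thesis .
    qed
    show "\<exists>M. \<forall>m\<ge>M. \<forall>n\<ge>M. norm (F m - F n) < e"
    proof (intro exI allI impI)
      fix m n assume "m \<ge> K" "n \<ge> K"
      then show "norm (F m - F n) < e"
        using norm_diff_triangle_less[OF *[of m], of "F n" "e/2"] *[of n] by (simp add: norm_minus_commute)
    qed
  qed
  then show ?thesis unfolding L_def
    by (simp add: Cauchy_convergent_iff convergent_LIMSEQ_iff)
qed

lemma norm_F_minus_L_le: "norm (F N - L) \<le> D / (real N + 1)"
proof -
  have "(\<lambda>M. norm (F M - F N)) \<longlonglongrightarrow> norm (L - F N)"
    by (intro tendsto_intros F_tendsto)
  moreover have "\<exists>K. \<forall>M\<ge>K. norm (F M - F N) \<le> D / (real N + 1)"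
    using norm_F_diff_le by blast
  ultimately have "norm (L - F N) \<le> D / (real N + 1)" by (rule LIMSEQ_le_const2)
  then show ?thesis by (simp add: norm_minus_commute)
qed

text \<open>
  The form in which the rate of convergence \<open>F(N) - L = O(1/N)\<close> is used: the factor \<open>d\<close> cancels
  the denominator in sums over \<open>\<xi>(d) / d\<close>.
\<close>

lemma quotient_tail_le:
  assumes "d \<in> {1..N}"
  shows "norm (F (N div d) - L) \<le> D * real d / real N"
proof -
  have "real N / real d < real (N div d) + 1" using assms by (intro divide_less_div_plus_1) auto
  then have "D / (real (N div d) + 1) \<le> D / (real N / real d)"
    using assms D_ge_1 by (intro divide_left_mono mult_pos_pos) auto
  then show ?thesis using norm_F_minus_L_le[of "N div d"] by simp
qed

text \<open>
  Abel summation applies from \<open>n = 3\<close> on, where \<open>ln n / n\<close> starts to decrease; the terms before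
  are bounded by \<open>1\<close> directly.
\<close>

lemma norm_sum_ln_over_le:
  "norm (\<Sum>n=1..N. \<xi> n * of_real (ln (real n) / real n)) \<le> D + 1"
proof -
  let ?f = "\<lambda>n. ln (real n) / real n"
  have f1: "?f n \<le> 1" for n
    using ln_bound[of "real n"] by (cases "n = 0") (auto simp: field_simps)
  have f0: "?f n \<ge> 0" for n
    by (cases "n = 0") auto
  have mono: "?f (Suc n) \<le> ?f n" if n: "n \<ge> 3" for n
  proof -
    have "ln (real (Suc n)) - ln (real n) = ln (real (Suc n) / real n)"
      using n by (simp add: ln_div)
    also have "real (Suc n) / real n = 1 + 1 / real n" using n by (simp add: field_simps)
    also have "ln \<dots> \<le> 1 / real n" by (rule ln_add_one_self_le_self) auto
    finally have "real n * (ln (real (Suc n)) - ln (real n)) \<le> 1" using n by (simp add: field_simps)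
    \<comment> \<open>this is where \<open>n \<ge> 3\<close> enters: \<open>exp 1 \<le> 3\<close>\<close>
    also have "1 \<le> ln (real n)"
      using n exp_le by (subst ln_ge_iff) auto
    finally show ?thesis using n by (simp add: field_simps)
  qed
  have small: "norm (\<Sum>n=1..N. \<xi> n * of_real (?f n)) \<le> 1" if le: "N \<le> 2" for N
  proof -
    consider "N = 0" | "N = 1" | "N = 2" using le by linarith
    then show ?thesis
    proof cases
      case 3
      then have eq: "(\<Sum>n=1..N. \<xi> n * of_real (?f n)) = \<xi> 2 * of_real (?f 2)"
        by (simp add: numeral_2_eq_2)
      then show ?thesis using norm_le_1[of 2] f1[of 2] f0[of 2]
        unfolding eq norm_mult norm_of_real
        by (intro mult_le_one) (auto simp del: of_nat_numeral)
    qed auto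
  qed
  show ?thesis
  proof (cases "N \<le> 2")
    case True
    then show ?thesis using small[OF True] D_ge_1 by linarith
  next
    case False
    have split: "(\<Sum>n=1..N. \<xi> n * of_real (?f n)) = 
       (\<Sum>n=1..2. \<xi> n * of_real (?f n)) + (\<Sum>n=3..N. \<xi> n * of_real (?f n))"
      using False by (subst sum.union_disjoint[symmetric]) (auto intro!: sum.cong)
    have "norm (\<Sum>n=3..N. \<xi> n * of_real (?f n)) \<le> D * ?f 3"
      using False by (intro norm_sum_mult_antimono_le bound mono f0) auto
    moreover have "D * ?f 3 \<le> D" using f1[of 3] D_ge_1 by (simp add: mult_left_le)
    ultimately show ?thesis
      unfolding split using small[OF order.refl] norm_triangle_ineq[of "\<Sum>n=1..2. \<xi> n * of_real (?f n)"
        "\<Sum>n=3..N. \<xi> n * of_real (?f n)"] by linarith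
  qed
qed

text \<open>
  Writing \<open>ln n\<close> as \<open>\<Sum>d|n. \<Lambda>(d)\<close> turns the bounded sum of \<open>\<xi>(n) ln n / n\<close> into
  \<open>\<Sum>d\<le>N. \<xi>(d) \<Lambda>(d) / d * F(N div d)\<close>. Replacing \<open>F(N div d)\<close> by \<open>L\<close> costs
  \<open>O(1/N) \<Sum>d\<le>N. \<Lambda>(d) = O(1)\<close>, so \<open>L * S(N)\<close> is bounded.
\<close>

lemma S_bounded_if_L_nonzero:
  assumes "L \<noteq> 0"
  shows "\<exists>B. \<forall>N. norm (S N) \<le> B"
proof (intro exI allI)
  fix N
  show "norm (S N) \<le> (5 * D + 1) / norm L"
  proof (cases "N = 0")
    case True
    then show ?thesis using D_ge_1 by (simp add: S_def)
  next
    case False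
    let ?g = "\<lambda>d m. \<xi> d * mangoldt d / of_nat d * (\<xi> m / of_nat m)"
    have "(\<Sum>n=1..N. \<xi> n * of_real (ln (real n) / real n)) = (\<Sum>n=1..N. \<Sum>d | d dvd n. ?g d (n div d))"
    proof (intro sum.cong refl)
      fix n assume n: "n \<in> {1..N}"
      have "(\<Sum>d | d dvd n. ?g d (n div d)) = (\<Sum>d | d dvd n. \<xi> n / of_nat n * mangoldt d)"
      proof (intro sum.cong refl)
        fix d assume "d \<in> {d. d dvd n}"
        then obtain k where k: "n = d * k" by auto
        then show "?g d (n div d) = \<xi> n / of_nat n * mangoldt d"
          using n by (simp add: mult)
      qed
      also have "\<dots> = \<xi> n / of_nat n * of_real (ln (real n))"
        using n by (subst sum_distrib_left[symmetric], subst mangoldt_sum) auto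
      finally show "\<xi> n * of_real (ln (real n) / real n) = (\<Sum>d | d dvd n. ?g d (n div d))"
        by simp
    qed
    also have "\<dots> = (\<Sum>d=1..N. \<Sum>m=1..N div d. ?g d m)"
      by (rule sum_divisors_eq_sum_multiples)
    also have "\<dots> = (\<Sum>d=1..N. \<xi> d * mangoldt d / of_nat d * F (N div d))"
      by (simp only: F_def sum_distrib_left)
    also have "\<dots> = L * S N + (\<Sum>d=1..N. \<xi> d * mangoldt d / of_nat d * (F (N div d) - L))"
      unfolding S_def sum_distrib_left sum.distrib[symmetric]
      by (intro sum.cong refl) (simp add: right_diff_distrib diff_divide_distrib mult_ac)
    finally have eq: "L * S N = (\<Sum>n=1..N. \<xi> n * of_real (ln (real n) / real n)) -
        (\<Sum>d=1..N. \<xi> d * mangoldt d / of_nat d * (F (N div d) - L))" by simp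
    have "norm (\<Sum>d=1..N. \<xi> d * mangoldt d / of_nat d * (F (N div d) - L)) 
        \<le> (\<Sum>d=1..N. D / real N * mangoldt d)"
    proof (rule sum_norm_le)
      fix d assume d: "d \<in> {1..N}"
      have "norm (\<xi> d * mangoldt d / of_nat d * (F (N div d) - L))
          = norm (\<xi> d) * (mangoldt d / real d * norm (F (N div d) - L))"
        by (simp add: norm_mult norm_divide mangoldt_nonneg)
      also have "\<dots> \<le> 1 * (mangoldt d / real d * (D * real d / real N))"
        using quotient_tail_le[OF d] norm_le_1[of d] by (intro mult_mono mult_left_mono) 
          (auto simp: mangoldt_nonneg)
      also have "\<dots> = D / real N * mangoldt d" using d by simp
      finally show "norm (\<xi> d * mangoldt d / of_nat d * (F (N div d) - L)) \<le> D / real N * mangoldt d" .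
    qed
    also have "\<dots> = D / real N * (\<Sum>d=1..N. mangoldt d)" by (simp add: sum_distrib_left)
    also have "\<dots> \<le> D / real N * (4 * real N)"
      using D_ge_1 by (intro mult_left_mono sum_mangoldt_le) auto
    also have "\<dots> = 4 * D" using False by simp
    finally have "norm (L * S N) \<le> D + 1 + 4 * D"
      unfolding eq using norm_sum_ln_over_le[of N] by (intro order.trans[OF norm_triangle_ineq4]) linarith
    then show ?thesis using assms by (simp add: norm_mult field_simps)
  qed
qed

text \<open>
  Here \<open>\<Sum>d|n. \<mu>(d) (ln N - ln d)\<close> equals \<open>\<Lambda>(n)\<close>, plus \<open>ln N\<close> at \<open>n = 1\<close>. Summed against
  \<open>\<xi>(n) / n\<close> and reordered, it becomes a sum of \<open>\<mu>(d) \<xi>(d) / d * (ln N - ln d) * F(N div d)\<close>, where now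
  \<open>F(N div d)\<close> itself is \<open>O(d/N)\<close>; and \<open>\<Sum>d\<le>N. ln (N/d) = N ln N - ln (fact N)\<close> is \<open>O(N)\<close>.
\<close>

lemma S_near_minus_ln_if_L_zero:
  assumes "L = 0"
  shows "\<exists>B. \<forall>N>0. norm (S N + of_real (ln (real N))) \<le> B"
proof (intro exI allI impI)
  fix N :: nat assume N: "N > 0"
  let ?g = "\<lambda>d m. \<xi> d * of_real (moebius d * (ln (real N) - ln (real d))) / of_nat d * (\<xi> m / of_nat m)"
  have "S N + of_real (ln (real N)) = (\<Sum>n=1..N. \<xi> n / of_nat n * 
         (mangoldt n + (if n = 1 then of_real (ln (real N)) else 0)))"
    using N one by (simp add: S_def distrib_left sum.distrib if_distrib[of "\<lambda>x. _ * x"] cong: if_cong)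
  also have "\<dots> = (\<Sum>n=1..N. \<Sum>d | d dvd n. ?g d (n div d))"
  proof (intro sum.cong refl)
    fix n assume n: "n \<in> {1..N}"
    have "(\<Sum>d | d dvd n. ?g d (n div d)) 
        = (\<Sum>d | d dvd n. \<xi> n / of_nat n * of_real (moebius d * (ln (real N) - ln (real d))))"
    proof (intro sum.cong refl)
      fix d assume "d \<in> {d. d dvd n}"
      then obtain k where k: "n = d * k" by auto
      then show "?g d (n div d) = \<xi> n / of_nat n * of_real (moebius d * (ln (real N) - ln (real d)))"
        using n by (simp add: mult)
    qed
    also have "\<dots> = \<xi> n / of_nat n * of_real (\<Sum>d | d dvd n. moebius d * (ln (real N) - ln (real d)))"
      by (simp only: sum_distrib_left of_real_sum)
    also have "(\<Sum>d | d dvd n. moebius d * (ln (real N) - ln (real d))) =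
       (\<Sum>d | d dvd n. moebius d) * ln (real N) - (\<Sum>d | d dvd n. moebius d * ln (real d))"
      by (simp add: right_diff_distrib sum_subtractf sum_distrib_right)
    also have "\<dots> = mangoldt n + (if n = 1 then ln (real N) else 0)"
      using n by (simp add: sum_moebius_divisors sum_moebius_ln_divisors)
    finally show "\<xi> n / of_nat n * (mangoldt n + (if n = 1 then of_real (ln (real N)) else 0))
        = (\<Sum>d | d dvd n. ?g d (n div d))"
      by (simp split: if_splits)
  qed
  also have "\<dots> = (\<Sum>d=1..N. \<Sum>m=1..N div d. ?g d m)"
    by (rule sum_divisors_eq_sum_multiples)
  also have "\<dots> = (\<Sum>d=1..N. \<xi> d * of_real (moebius d * (ln (real N) - ln (real d))) / of_nat d * F (N div d))"
    by (simp only: F_def sum_distrib_left)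
  finally have eq: "S N + of_real (ln (real N)) = \<dots>" .
  have "norm (S N + of_real (ln (real N))) \<le> (\<Sum>d=1..N. D / real N * (ln (real N) - ln (real d)))"
    unfolding eq
  proof (rule sum_norm_le)
    fix d assume d: "d \<in> {1..N}"
    have nn: "ln (real N) - ln (real d) \<ge> 0" using d by simp
    have "norm (\<xi> d * of_real (moebius d * (ln (real N) - ln (real d))) / of_nat d * F (N div d))
        = (norm (\<xi> d) * \<bar>moebius d\<bar>) * ((ln (real N) - ln (real d)) / real d * norm (F (N div d) - L))"
      using nn assms by (simp only: norm_mult norm_divide norm_of_real abs_mult) simp
    also have "\<dots> \<le> 1 * ((ln (real N) - ln (real d)) / real d * (D * real d / real N))"
      using quotient_tail_le[OF d] norm_le_1[of d] abs_moebius_le[of d] nn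
      by (intro mult_mono mult_left_mono mult_le_one) auto
    also have "\<dots> = D / real N * (ln (real N) - ln (real d))" using d by simp
    finally show "norm (\<xi> d * of_real (moebius d * (ln (real N) - ln (real d))) / of_nat d * F (N div d))
      \<le> D / real N * (ln (real N) - ln (real d))" .
  qed
  also have "\<dots> = D / real N * (real N * ln (real N) - ln (fact N))"
    by (simp only: sum_distrib_left[symmetric] sum_subtractf ln_fact_eq_sum_ln) simp
  also have "\<dots> \<le> D / real N * real N"
    using D_ge_1 ln_fact_bounds(2)[OF N] by (intro mult_left_mono) auto
  also have "\<dots> = D" using N by simp
  finally show "norm (S N + of_real (ln (real N))) \<le> D" .
qed

end

section \<open>Nonvanishing for real functions\<close>

lemma divisors_prime_power_mult:
  fixes q m :: nat
  assumes q: "prime q" and m: "\<not> q dvd m"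
  shows "bij_betw (\<lambda>(i, e). q ^ i * e) ({..k} \<times> {e. e dvd m}) {d. d dvd q ^ k * m}"
  unfolding bij_betw_def
proof
  show "inj_on (\<lambda>(i, e). q ^ i * e) ({..k} \<times> {e. e dvd m})"
  proof (intro inj_onI, clarsimp)
    fix i e j f assume *: "e dvd m" "f dvd m" "q ^ i * e = q ^ j * f"
    then have "\<not> q dvd e" "\<not> q dvd f" using m dvd_trans by blast+
    then show "i = j \<and> e = f"
      using prime_power_cancel2[OF q, of e i f j] *(3) by (metis mult.commute)
  qed
  show "(\<lambda>(i, e). q ^ i * e) ` ({..k} \<times> {e. e dvd m}) = {d. d dvd q ^ k * m}"
  proof (intro equalityI subsetI)
    fix d assume "d \<in> {d. d dvd q ^ k * m}"
    then obtain b c where bc: "d = b * c" "b dvd q ^ k" "c dvd m"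
      using division_decomp by blast
    then obtain i where "i \<le> k" "b = q ^ i"
      using q by (auto simp: divides_primepow_nat)
    then show "d \<in> (\<lambda>(i, e). q ^ i * e) ` ({..k} \<times> {e. e dvd m})"
      using bc by (auto intro!: image_eqI[of _ _ "(i, c)"])
  qed (auto intro!: mult_dvd_mono le_imp_power_dvd)
qed

text \<open>
  The error in approximating the sum of \<open>1 / sqrt m\<close> by the integral. It is the monotonicity
  of this error that makes Abel summation applicable to it below, so that its limit never has to be
  known.
\<close>

definition sqrt_defect :: "nat \<Rightarrow> real" where
  "sqrt_defect y = 2 * sqrt (real y) - (\<Sum>m=1..y. 1 / sqrt (real m))"

lemma sqrt_defect_bounds:
  shows "mono sqrt_defect" and "sqrt_defect y \<ge> 0" and "sqrt_defect y \<le> 2"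
proof -
  \<comment> \<open>the difference of consecutive square roots, compared with the derivative at both ends\<close>
  have step: "1 / sqrt (real (Suc y)) \<le> 2 * (sqrt (real (Suc y)) - sqrt (real y))"
    "2 * (sqrt (real (Suc (Suc y))) - sqrt (real (Suc y))) \<le> 1 / sqrt (real (Suc y))" for y
  proof -
    define a b c where "a = sqrt (real y)" and "b = sqrt (real (Suc y))" and "c = sqrt (real (Suc (Suc y)))"
    have abc: "a \<ge> 0" "a \<le> b" "b > 0" "b \<le> c" by (auto simp: a_def b_def c_def)
    have sq: "a ^ 2 = real y" "b ^ 2 = real y + 1" "c ^ 2 = real y + 2"
      by (auto simp: a_def b_def c_def)
    have "1 = (b - a) * (b + a)" using sq by (simp add: algebra_simps power2_eq_square)
    also have "\<dots> \<le> (b - a) * (2 * b)" using abc by (intro mult_left_mono) auto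
    finally show "1 / sqrt (real (Suc y)) \<le> 2 * (sqrt (real (Suc y)) - sqrt (real y))"
      using abc unfolding a_def[symmetric] b_def[symmetric] by (simp add: field_simps)
    have "(c - b) * (2 * b) \<le> (c - b) * (c + b)" using abc by (intro mult_left_mono) auto
    also have "\<dots> = 1" using sq by (simp add: algebra_simps power2_eq_square)
    finally show "2 * (sqrt (real (Suc (Suc y))) - sqrt (real (Suc y))) \<le> 1 / sqrt (real (Suc y))"
      using abc unfolding c_def[symmetric] b_def[symmetric] by (simp add: field_simps)
  qed
  show mono: "mono sqrt_defect"
  proof (subst incseq_Suc_iff, intro allI)
    show "sqrt_defect y \<le> sqrt_defect (Suc y)" for y
      using step(1)[of y] by (simp add: sqrt_defect_def)
  qed
  show "sqrt_defect y \<ge> 0" using monoD[OF mono, of 0 y] by (simp add: sqrt_defect_def)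
  have "2 * sqrt (real (Suc y)) - 2 \<le> (\<Sum>m=1..y. 1 / sqrt (real m))"
  proof (induction y)
    case (Suc y)
    then show ?case using step(2)[of y] by simp
  qed simp
  moreover have "sqrt (real y) \<le> sqrt (real (Suc y))" by simp
  ultimately show "sqrt_defect y \<le> 2" unfolding sqrt_defect_def by linarith
qed

context oscillating_multiplicative
begin

text \<open>
  The coefficients of the product of the zeta series with the series of \<open>\<xi>\<close>.
\<close>

definition r :: "nat \<Rightarrow> complex" where "r n = (\<Sum>d | d dvd n. \<xi> d)"

lemma power: "\<xi> (n ^ k) = \<xi> n ^ k"
  using one by (induction k) (auto simp: mult)

lemma r_prime_power_mult:
  assumes "prime q" "\<not> q dvd m"
  shows "r (q ^ k * m) = (\<Sum>i\<le>k. \<xi> q ^ i) * r m"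
proof -
  have "r (q ^ k * m) = (\<Sum>(i, e)\<in>{..k} \<times> {e. e dvd m}. \<xi> (q ^ i * e))"
    unfolding r_def by (subst sum.reindex_bij_betw[OF divisors_prime_power_mult[OF assms], symmetric])
      (simp add: case_prod_unfold)
  also have "\<dots> = (\<Sum>i\<le>k. \<xi> q ^ i) * r m"
    unfolding r_def sum_product sum.cartesian_product by (simp add: mult power)
  finally show ?thesis .
qed

text \<open>
  By multiplicativity it suffices to look at prime powers, where \<open>r\<close> is a geometric sum
  with ratio \<open>0\<close>, \<open>1\<close> or \<open>-1\<close>. The condition on multiplicities says that \<open>n\<close> is a square, in a form
  that passes to the cofactor of a prime power.
\<close>

lemma r_real_lower_bounds:
  assumes real: "\<And>n. \<xi> n \<in> \<real>" and "n > 0"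
  shows "r n \<in> \<real>" and "0 \<le> Re (r n)"
    and "(\<forall>q. prime q \<longrightarrow> even (multiplicity q n)) \<longrightarrow> 1 \<le> Re (r n)"
proof -
  show "r n \<in> \<real>" unfolding r_def by (intro sum_in_Reals real)
  have "0 \<le> Re (r n) \<and> ((\<forall>q. prime q \<longrightarrow> even (multiplicity q n)) \<longrightarrow> 1 \<le> Re (r n))"
    using \<open>n > 0\<close>
  proof (induction n rule: less_induct)
    case (less n)
    show ?case
    proof (cases "n = 1")
      case True
      then show ?thesis using one by (simp add: r_def)
    next
      case False
      then obtain q where q: "prime q" "q dvd n" using prime_factor_nat by blast
      define k where "k = multiplicity q n"
      obtain m where m: "n = q ^ k * m" "\<not> q dvd m"
        unfolding k_def using less.prems q(1) multiplicity_decompose'[of n q] by (auto simp: prime_nat_iff)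
      have k: "k > 0" using m q by (metis gr0I mult_1 power_0)
      have mpos: "m > 0" using m less.prems by (auto intro: Nat.gr0I)
      have "1 < q ^ k" using one_less_power[OF prime_gt_1_nat[OF q(1)] k] by simp
      then have "m < n" using m(1) mpos by simp
      note IH = less.IH[OF this mpos]
      define s where "s = (\<Sum>i\<le>k. Re (\<xi> q) ^ i)"
      have xq: "\<xi> q = of_real (Re (\<xi> q))" using real[of q] by (simp add: of_real_Re)
      have "r n = (\<Sum>i\<le>k. \<xi> q ^ i) * r m"
        unfolding m(1) by (rule r_prime_power_mult[OF q(1) m(2)])
      also have "(\<Sum>i\<le>k. \<xi> q ^ i) = of_real s" unfolding s_def by (subst xq) simp
      finally have rn: "Re (r n) = s * Re (r m)" by simp
      have s: "0 \<le> s \<and> (even k \<longrightarrow> 1 \<le> s)"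
      proof -
        have "\<bar>Re (\<xi> q)\<bar> = 1" if "\<xi> q \<noteq> 0"
          using unimodular[of q] that by (subst (asm) (2) xq) (simp del: of_real_Re)
        then consider "Re (\<xi> q) = 0" | "Re (\<xi> q) = 1" | "Re (\<xi> q) = -1" by fastforce
        then show ?thesis
        proof cases
          case 1
          then show ?thesis by (simp add: s_def power_0_left)
        next
          case 2
          then show ?thesis by (simp add: s_def)
        next
          case 3
          have "(\<Sum>i\<le>k. (-1::real) ^ i) = (if even k then 1 else 0)" by (induction k) auto
          then show ?thesis by (simp add: s_def 3)
        qed
      qed
      show ?thesis
      proof (intro conjI impI)
        show "0 \<le> Re (r n)" using rn s IH by simp
        assume ev: "\<forall>q. prime q \<longrightarrow> even (multiplicity q n)"
        have "even (multiplicity p m)" if p: "prime p" for p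
        proof (cases "p = q")
          case True
          then show ?thesis using m(2) by (simp add: not_dvd_imp_multiplicity_0)
        next
          case False
          have "multiplicity p n = multiplicity p (q ^ k) + multiplicity p m"
            unfolding m(1) using p mpos q(1)
            by (intro prime_elem_multiplicity_mult_distrib) (auto simp: prime_gt_0_nat)
          also have "multiplicity p (q ^ k) = 0"
            using False p q(1) by (intro multiplicity_distinct_prime_power) auto
          finally show ?thesis using ev p by (metis add_0)
        qed
        then have "1 \<le> Re (r m)" using IH by blast
        moreover have "1 \<le> s" using s ev q(1) by (simp add: k_def)
        ultimately show "1 \<le> Re (r n)" unfolding rn using mult_mono[of 1 s 1 "Re (r m)"] by simp
      qed
    qed
  qed
  then show "0 \<le> Re (r n)" 
    and "(\<forall>q. prime q \<longrightarrow> even (multiplicity q n)) \<longrightarrow> 1 \<le> Re (r n)" by auto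
qed

text \<open>
  The sum equals \<open>\<Sum>d\<le>N. \<xi>(d) g(d)\<close> with \<open>N = M\<^sup>2\<close> and
  \<open>g(d) = 1 / sqrt d * (\<Sum>m\<le>N div d. 1 / sqrt m)\<close>, which decreases in \<open>d\<close>. Beyond \<open>d = M\<close> Abel summation
  suffices, because \<open>g(M + 1)\<close> is at most \<open>2\<close>. Up to \<open>M\<close>, \<open>g(d)\<close> is \<open>2 M / d\<close> up to errors that
  contribute \<open>O(1)\<close>, and the main term contributes \<open>2 M F(M) = O(1)\<close> as \<open>L = 0\<close>.
\<close>

lemma sum_r_over_sqrt_bounded_if_L_zero:
  assumes "L = 0" and "M \<ge> 2"
  shows "norm (\<Sum>n=1..M\<^sup>2. r n / of_real (sqrt (real n))) \<le> 6 * D + 2"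
proof -
  define N where "N = M\<^sup>2"
  define H where "H = (\<lambda>y. \<Sum>m=1..y. 1 / sqrt (real m))"
  define g where "g = (\<lambda>d. 1 / sqrt (real d) * H (N div d))"
  note e = sqrt_defect_bounds
  have e_def: "sqrt_defect y = 2 * sqrt (real y) - H y" for y
    by (simp add: sqrt_defect_def H_def)
  have M: "M < N" using assms(2) by (simp add: N_def power2_eq_square)
  have sqN: "sqrt (real N) = real M" by (simp add: N_def real_sqrt_unique)
  have H_mono: "H y \<le> H z" if "y \<le> z" for y z
    unfolding H_def using that by (intro sum_mono2) auto
  have H_nonneg: "H y \<ge> 0" for y unfolding H_def by (intro sum_nonneg) auto
  have g_mono: "g (Suc d) \<le> g d" if "d > 0" for d
    unfolding g_def using that 
    by (intro mult_mono H_mono frac_le div_le_mono2) (auto simp: H_nonneg)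

  have "(\<Sum>n=1..N. r n / of_real (sqrt (real n))) = (\<Sum>n=1..N. \<Sum>d | d dvd n.
          \<xi> d * of_real (1 / sqrt (real d) * (1 / sqrt (real (n div d)))))"
    unfolding r_def sum_divide_distrib
  proof (intro sum.cong refl)
    fix n d assume "n \<in> {1..N}" "d \<in> {d. d dvd n}"
    then obtain k where k: "n = d * k" "d > 0" by (auto elim!: dvdE)
    then show "\<xi> d / of_real (sqrt (real n)) 
        = \<xi> d * of_real (1 / sqrt (real d) * (1 / sqrt (real (n div d))))"
      by (simp add: real_sqrt_mult)
  qed
  also have "\<dots> = (\<Sum>d=1..N. \<Sum>m=1..N div d. \<xi> d * of_real (1 / sqrt (real d) * (1 / sqrt (real m))))"
    by (rule sum_divisors_eq_sum_multiples)
  also have "\<dots> = (\<Sum>d=1..N. \<xi> d * of_real (g d))"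
    by (simp only: g_def H_def sum_distrib_left of_real_sum)
  also have "\<dots> = (\<Sum>d=1..M. \<xi> d * of_real (g d)) + (\<Sum>d=Suc M..N. \<xi> d * of_real (g d))"
    using M by (subst sum.union_disjoint[symmetric]) (auto intro!: sum.cong)
  finally have split: "(\<Sum>n=1..N. r n / of_real (sqrt (real n))) = \<dots>" .

  have upper: "norm (\<Sum>d=Suc M..N. \<xi> d * of_real (g d)) \<le> 2 * D"
  proof -
    have "norm (\<Sum>d=Suc M..N. \<xi> d * of_real (g d)) \<le> D * g (Suc M)"
      using M by (intro norm_sum_mult_antimono_le bound g_mono) (auto simp: g_def H_nonneg)
    also have "g (Suc M) \<le> 1 / sqrt (real (Suc M)) * (2 * sqrt (real (Suc M)))"
    proof -
      have "N div Suc M \<le> Suc M" by (simp add: N_def power2_eq_square div_le_mono less_mult_imp_div_less order.strict_implies_order)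
      then have "H (N div Suc M) \<le> H (Suc M)" by (rule H_mono)
      also have "\<dots> \<le> 2 * sqrt (real (Suc M))" using e(2)[of "Suc M"] unfolding e_def by linarith
      finally show ?thesis unfolding g_def by (intro mult_left_mono) auto
    qed
    also have "\<dots> = 2" by simp
    finally show ?thesis using D_ge_1 by simp
  qed

  have lower: "norm (\<Sum>d=1..M. \<xi> d * of_real (g d)) \<le> 4 * D + 2"
  proof -
    let ?u = "\<lambda>d. 2 * (sqrt (real N / real d) - sqrt (real (N div d))) / sqrt (real d)"
    \<comment> \<open>the main term, the rounding error of \<open>N div d\<close>, and the error of the integral approximation\<close>
    have g_eq: "g d = 2 * real M / real d - ?u d - 1 / sqrt (real d) * sqrt_defect (N div d)" if "d > 0" for d
    proof -
      have "2 * real M / real d = 2 * sqrt (real N / real d) / sqrt (real d)"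
        using that by (simp add: sqN real_sqrt_divide)
      then show ?thesis by (simp add: g_def e_def algebra_simps diff_divide_distrib)
    qed
    have "(\<Sum>d=1..M. \<xi> d * of_real (g d)) = (\<Sum>d=1..M. \<xi> d * of_real (2 * real M / real d))
       - (\<Sum>d=1..M. \<xi> d * of_real (?u d)) - (\<Sum>d=1..M. \<xi> d * of_real (1 / sqrt (real d) * sqrt_defect (N div d)))"
      unfolding sum_subtractf[symmetric] 
      by (intro sum.cong refl) (simp only: g_eq of_real_diff right_diff_distrib atLeastAtMost_iff, 
        subst g_eq, auto simp: algebra_simps)
    moreover have "norm (\<Sum>d=1..M. \<xi> d * of_real (2 * real M / real d)) \<le> 2 * D"
    proof -
      have "(\<Sum>d=1..M. \<xi> d * of_real (2 * real M / real d)) = of_real (2 * real M) * F M"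
        by (simp add: F_def sum_distrib_left mult_ac)
      also have "norm \<dots> \<le> 2 * real M * (D / (real M + 1))"
        using mult_left_mono[OF norm_F_minus_L_le[of M], of "2 * real M"] assms by (simp add: norm_mult)
      also have "\<dots> \<le> 2 * D" using D_ge_1 by (simp add: field_simps)
      finally show ?thesis .
    qed
    moreover have "norm (\<Sum>d=1..M. \<xi> d * of_real (?u d)) \<le> 2"
    proof -
      have "norm (\<Sum>d=1..M. \<xi> d * of_real (?u d)) \<le> (\<Sum>d=1..M. 2 / real M)"
      proof (rule sum_norm_le)
        fix d assume d: "d \<in> {1..M}"
        define a b where "a = sqrt (real N / real d)" and "b = sqrt (real (N div d))"
        have dN: "d \<le> N" using d M by simp
        have a: "a > 0" using d M by (simp add: a_def)
        have b: "0 \<le> b" "b \<le> a" unfolding a_def b_def by (auto simp: of_nat_div_le_of_nat)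
        have "(a - b) * a \<le> (a - b) * (a + b)" using b by (intro mult_left_mono) auto
        also have "\<dots> = real N / real d - real (N div d)"
          by (simp add: a_def b_def algebra_simps flip: power2_eq_square)
        also have "\<dots> \<le> 1" using divide_less_div_plus_1[of d N] d by simp
        finally have ab: "a - b \<le> 1 / a" using a by (simp add: field_simps)
        have "norm (\<xi> d * of_real (?u d)) = norm (\<xi> d) * (2 * (a - b) / sqrt (real d))"
          unfolding a_def[symmetric] b_def[symmetric] norm_mult norm_of_real using b by simp
        also have "\<dots> \<le> 1 * (2 * (1 / a) / sqrt (real d))"
          using norm_le_1[of d] ab b by (intro mult_mono divide_right_mono mult_left_mono) auto
        also have "\<dots> = 2 / real M" using d by (simp add: a_def real_sqrt_divide sqN)
        finally show "norm (\<xi> d * of_real (?u d)) \<le> 2 / real M" .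
      qed
      also have "\<dots> = 2" using assms(2) by simp
      finally show ?thesis .
    qed
    moreover have "norm (\<Sum>d=1..M. \<xi> d * of_real (1 / sqrt (real d) * sqrt_defect (N div d))) \<le> 2 * D"
    proof -
      have "norm (\<Sum>d=1..M. \<xi> d * of_real (1 / sqrt (real d) * sqrt_defect (N div d))) 
          \<le> D * (1 / sqrt (real 1) * sqrt_defect (N div 1))"
        using assms(2) e(2) 
        by (intro norm_sum_mult_antimono_le bound mult_mono frac_le monoD[OF e(1)] div_le_mono2) auto
      also have "\<dots> \<le> D * 2" using e(3)[of N] D_ge_1 by (intro mult_left_mono) auto
      finally show ?thesis by simp
    qed
    moreover have "norm (x - y - z) \<le> norm x + norm y + norm z" for x y z :: complex
      using norm_triangle_ineq4[of "x - y" z] norm_triangle_ineq4[of x y] by linarith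
    ultimately show ?thesis by (smt (verit))
  qed
  show ?thesis
    unfolding N_def[symmetric] split using upper lower by (intro order.trans[OF norm_triangle_ineq]) linarith
qed

text \<open>
  The squares alone make the sum of \<open>r(n) / sqrt n\<close> over \<open>n \<le> M\<^sup>2\<close> at least the harmonic number of \<open>M\<close>.
\<close>

theorem L_nonzero_if_real:
  assumes real: "\<And>n. \<xi> n \<in> \<real>"
  shows "L \<noteq> 0"
proof
  assume L: "L = 0"
  have "eventually (\<lambda>M. harm M > 6 * D + 2) sequentially"
    using harm_at_top by (simp add: filterlim_at_top_dense)
  then obtain M where M: "M \<ge> 2" "harm M > 6 * D + 2"
    unfolding eventually_sequentially by (metis le_trans nat_le_linear)
  have "harm M = (\<Sum>m=1..M. 1 / sqrt (real (m\<^sup>2)))"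
    by (simp add: harm_def divide_inverse)
  also have "\<dots> = (\<Sum>n\<in>(\<lambda>m. m\<^sup>2) ` {1..M}. 1 / sqrt (real n))"
    by (subst sum.reindex) (auto simp: inj_on_def)
  also have "\<dots> \<le> (\<Sum>n\<in>(\<lambda>m. m\<^sup>2) ` {1..M}. Re (r n) / sqrt (real n))"
  proof (rule sum_mono)
    fix n assume "n \<in> (\<lambda>m. m\<^sup>2) ` {1..M}"
    then obtain m where m: "n = m\<^sup>2" "m > 0" by auto
    then have "even (multiplicity q n)" if "prime q" for q
      using that by (simp add: prime_elem_multiplicity_power_distrib)
    then show "1 / sqrt (real n) \<le> Re (r n) / sqrt (real n)"
      using r_real_lower_bounds(3)[OF real, of n] m by (intro divide_right_mono) auto
  qed
  also have "\<dots> \<le> (\<Sum>n=1..M\<^sup>2. Re (r n) / sqrt (real n))"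
    using r_real_lower_bounds(2)[OF real] by (intro sum_mono2) (auto intro: power_mono)
  also have "\<dots> = Re (\<Sum>n=1..M\<^sup>2. r n / of_real (sqrt (real n)))"
    by simp
  also have "\<dots> \<le> norm (\<Sum>n=1..M\<^sup>2. r n / of_real (sqrt (real n)))"
    by (rule complex_Re_le_cmod)
  also have "\<dots> \<le> 6 * D + 2"
    by (rule sum_r_over_sqrt_bounded_if_L_zero[OF L M(1)])
  finally show False using M(2) by simp
qed

end

section \<open>Periodic functions and roots of unity\<close>

lemma norm_sum_periodic_le:
  fixes f :: "nat \<Rightarrow> complex"
  assumes p: "p > 0" and per: "\<And>n. f (n + p) = f n" and zero: "(\<Sum>n<p. f n) = 0"
    and le1: "\<And>n. norm (f n) \<le> 1"
  shows "norm (\<Sum>n=a..b. f n) \<le> 2 * real p"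
proof -
  have shift: "(\<Sum>n<m + p. f n) = (\<Sum>n<m. f n)" for m
    by (induction m) (auto simp: zero per)
  have init: "norm (\<Sum>n<N. f n) \<le> real p" for N
  proof (induction N rule: less_induct)
    case (less N)
    show ?case
    proof (cases "N < p")
      case True
      have "norm (\<Sum>n<N. f n) \<le> (\<Sum>n<N. 1)" by (rule sum_norm_le) (rule le1)
      then show ?thesis using True by simp
    next
      case False
      then show ?thesis using less[of "N - p"] shift[of "N - p"] p by simp
    qed
  qed
  show ?thesis
  proof (cases "a \<le> b")
    case True
    have "(\<Sum>n<Suc b. f n) = (\<Sum>n<a. f n) + (\<Sum>n=a..b. f n)"
      using True by (subst sum.union_disjoint[symmetric]) (auto intro!: sum.cong simp del: sum.lessThan_Suc)
    then have "(\<Sum>n=a..b. f n) = (\<Sum>n<Suc b. f n) - (\<Sum>n<a. f n)" by (simp add: algebra_simps)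
    then show ?thesis
      using init[of "Suc b"] init[of a] norm_triangle_ineq4[of "\<Sum>n<Suc b. f n" "\<Sum>n<a. f n"] by simp
  qed simp
qed

definition unity_root :: "nat \<Rightarrow> nat \<Rightarrow> complex" where
  "unity_root n j = exp (2 * of_real pi * \<i> * of_nat j / of_nat n)"

lemma unity_root_cong_iff:
  assumes "n > 0"
  shows "unity_root n i = unity_root n j \<longleftrightarrow> [i = j] (mod n)"
  using assms complex_root_unity_eq[of n i j] by (simp add: unity_root_def Cong.cong_def)

lemma unity_root_add: "unity_root n (i + j) = unity_root n i * unity_root n j"
  by (simp add: unity_root_def exp_add[symmetric] ring_distribs add_divide_distrib)

lemma unity_root_0 [simp]: "unity_root n 0 = 1"
  by (simp add: unity_root_def)

lemma unity_root_mult: "unity_root n (k * i) = unity_root n i ^ k"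
  by (induction k) (auto simp: unity_root_add)

lemma norm_unity_root [simp]: "norm (unity_root n j) = 1"
  by (simp add: unity_root_def norm_exp_eq_Re)

lemma unity_root_power_self: 
  assumes "n > 0"
  shows "unity_root n i ^ n = 1"
  using unity_root_cong_iff[OF assms, of "n * i" 0]
  by (simp add: unity_root_mult cong_0_iff)

lemma sum_powers_eq_0:
  fixes w :: complex
  assumes "w ^ n = 1" "w \<noteq> 1"
  shows "(\<Sum>k<n. w ^ k) = 0"
  using assms by (simp add: geometric_sum)

lemma primitive_root_exists:
  assumes "prime p"
  obtains g where "residue_primroot p g"
proof -
  have "p \<in> cyclic_moduli"
  proof (cases "p = 2")
    case False
    then have "odd p" using assms primes_dvd_imp_eq two_is_prime_nat by blast
    then have "p \<in> {p ^ k |p k. prime p \<and> odd p \<and> k > 0}"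
      using assms by (intro CollectI exI[of _ p] exI[of _ "1::nat"]) simp
    then show ?thesis by (simp add: cyclic_moduli_def)
  qed (simp add: cyclic_moduli_def)
  then show ?thesis using that residue_primroot_iff_in_cyclic_moduli by blast
qed

section \<open>Logarithmic weights of sets of integers\<close>

definition mangoldt_weight :: "(nat \<Rightarrow> bool) \<Rightarrow> nat \<Rightarrow> real" where
  "mangoldt_weight P X = (\<Sum>n | n \<in> {1..X} \<and> P n. mangoldt n / real n)"

lemma mangoldt_weight_split:
  "mangoldt_weight P X = mangoldt_weight (\<lambda>n. P n \<and> Q n) X + mangoldt_weight (\<lambda>n. P n \<and> \<not> Q n) X"
  unfolding mangoldt_weight_def
  by (subst sum.union_disjoint[symmetric]) (auto intro!: sum.cong)

lemma mangoldt_weight_nonneg: "mangoldt_weight P X \<ge> 0"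
  unfolding mangoldt_weight_def by (intro sum_nonneg divide_nonneg_nonneg mangoldt_nonneg) auto

lemma mangoldt_weight_True: "mangoldt_weight (\<lambda>_. True) X = (\<Sum>n=1..X. mangoldt n / real n)"
  unfolding mangoldt_weight_def by (intro sum.cong) auto

lemma mangoldt_weight_mono:
  assumes "\<And>n. P n \<Longrightarrow> Q n"
  shows "mangoldt_weight P X \<le> mangoldt_weight Q X"
  unfolding mangoldt_weight_def using assms
  by (intro sum_mono2) (auto intro!: divide_nonneg_nonneg mangoldt_nonneg)

lemma mangoldt_weight_le_ln:
  assumes "X > 0"
  shows "mangoldt_weight P X \<le> ln (real X) + 4"
proof -
  have "mangoldt_weight P X \<le> mangoldt_weight (\<lambda>_. True) X" by (rule mangoldt_weight_mono) simp
  also have "\<dots> \<le> ln (real X) + 4"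
    unfolding mangoldt_weight_True by (rule sum_mangoldt_over_bounds(1)[OF assms])
  finally show ?thesis .
qed

text \<open>
  Only the powers \<open>q ^ k\<close> with \<open>k \<ge> 2\<close> contribute, and \<open>\<Sum>k\<ge>2. ln q / q ^ k\<close> is at most
  \<open>2 ln q / q\<^sup>2\<close>, which is summable since \<open>ln q\<close> is \<open>O(sqrt q)\<close>.
\<close>

lemma mangoldt_weight_nonprime_bounded:
  "\<exists>C. \<forall>X. mangoldt_weight (\<lambda>n. \<not> prime n) X \<le> C"
proof (intro exI allI)
  fix X :: nat
  have sm: "summable (\<lambda>n. 4 * (real n powr (-3/2)))"
    by (intro summable_mult) (simp add: summable_real_powr_iff)
  define A where "A = {q. prime q \<and> q \<le> X} \<times> {2..X}"
  have fin: "finite A" by (simp add: A_def)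
  have A_sub: "n \<in> (\<lambda>(q, k). q ^ k) ` A" 
    if n: "n \<in> {1..X}" "\<not> prime n" "primepow n" for n
  proof -
    obtain q k where qk: "prime q" "k > 0" "n = q ^ k"
      using n(3) unfolding primepow_def by (auto simp: prime_elem_nat_iff)
    then have "k \<noteq> 1" using n(2) by auto
    with qk have k: "k \<ge> 2" by auto
    have "q ^ 1 \<le> q ^ k" using qk(2) prime_gt_0_nat[OF qk(1)] by (intro power_increasing) auto
    moreover have "k < q ^ k" using qk(1) by (intro power_gt_expt prime_gt_Suc_0_nat)
    ultimately show ?thesis
      using qk k n(1) by (auto simp: A_def intro!: image_eqI[of _ _ "(q, k)"])
  qed
  have "mangoldt_weight (\<lambda>n. \<not> prime n) X 
      = (\<Sum>n | n \<in> {1..X} \<and> \<not> prime n \<and> primepow n. mangoldt n / real n)"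
    unfolding mangoldt_weight_def by (intro sum.mono_neutral_right) (auto simp: mangoldt_def)
  also have "\<dots> \<le> (\<Sum>n\<in>(\<lambda>(q, k). q ^ k) ` A. mangoldt n / real n)"
    using A_sub by (intro sum_mono2 finite_imageI fin) (auto intro!: divide_nonneg_nonneg mangoldt_nonneg)
  also have "\<dots> \<le> (\<Sum>(q, k)\<in>A. mangoldt (q ^ k) / real (q ^ k))"
    using sum_image_le[OF fin, of "\<lambda>n. mangoldt n / real n" "\<lambda>(q, k). q ^ k"]
    by (simp add: o_def case_prod_unfold mangoldt_nonneg)
  also have "\<dots> = (\<Sum>q | prime q \<and> q \<le> X. \<Sum>k=2..X. ln (real q) * (1 / real q) ^ k)"
    unfolding A_def sum.cartesian_product[symmetric]
    by (intro sum.cong refl) (simp add: mangoldt_primepow power_divide)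
  also have "\<dots> \<le> (\<Sum>q | prime q \<and> q \<le> X. 4 * (real q powr (-3/2)))"
  proof (rule sum_mono)
    fix q assume "q \<in> {q. prime q \<and> q \<le> X}"
    then have q: "q \<ge> 2" using prime_ge_2_nat by blast
    define t where "t = 1 / real q"
    have t: "0 < t" "t \<le> 1 / 2" using q by (auto simp: t_def field_simps)
    have "(\<Sum>k=2..X. t ^ k) \<le> 2 * t\<^sup>2"
    proof (cases "2 \<le> X")
      case True
      have "1 * (\<Sum>k=2..X. t ^ k) \<le> 2 * (1 - t) * (\<Sum>k=2..X. t ^ k)"
        using t by (intro mult_right_mono sum_nonneg) auto
      also have "\<dots> = 2 * (t\<^sup>2 - t ^ Suc X)"
        using sum_gp_multiplied[OF True, of t] by (simp only: mult.assoc)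
      also have "\<dots> \<le> 2 * t\<^sup>2" using t by simp
      finally show ?thesis by simp
    qed (use t in auto)
    moreover have "ln (real q) \<le> 2 * sqrt (real q)"
    proof -
      have "ln (real q) = 2 * ln (sqrt (real q))" using q by (simp add: ln_sqrt)
      also have "\<dots> \<le> 2 * sqrt (real q)" using q ln_bound[of "sqrt (real q)"] by simp
      finally show ?thesis .
    qed
    ultimately have "ln (real q) * (\<Sum>k=2..X. t ^ k) \<le> 2 * sqrt (real q) * (2 * t\<^sup>2)"
      using q t by (intro mult_mono sum_nonneg) auto
    also have "\<dots> = 4 * (sqrt (real q) / real q ^ 2)" by (simp add: t_def power_divide)
    also have "sqrt (real q) / real q ^ 2 = real q powr (1/2 - 2)"
      using q by (simp only: powr_diff) (simp add: powr_half_sqrt)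
    finally show "(\<Sum>k=2..X. ln (real q) * (1 / real q) ^ k) \<le> 4 * (real q powr (-3/2))"
      by (simp add: t_def sum_distrib_left)
  qed
  also have "\<dots> \<le> (\<Sum>n. 4 * (real n powr (-3/2)))"
    by (intro sum_le_suminf sm) auto
  finally show "mangoldt_weight (\<lambda>n. \<not> prime n) X \<le> (\<Sum>n. 4 * (real n powr (-3/2)))" .
qed

section \<open>Dirichlet characters modulo a prime\<close>

text \<open>
  A primitive root \<open>g\<close> identifies the nonzero classes modulo \<open>p\<close> with exponents modulo \<open>p - 1\<close>, so
  that the characters are explicit powers of a root of unity in the discrete logarithm.
\<close>

locale prime_modulus =
  fixes p g :: nat
  assumes p: "prime p" and g: "residue_primroot p g"
begin

lemma p_gt_1: "p > 1"
  using p by (rule prime_gt_1_nat)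

definition dlog :: "nat \<Rightarrow> nat" where
  "dlog n = (SOME i. [g ^ i = n] (mod p))"

lemma dlog:
  assumes "\<not> p dvd n"
  shows "[g ^ dlog n = n] (mod p)"
proof -
  have "n mod p \<in> totatives p"
    using assms p_gt_1 by (auto simp: totatives_prime[OF p] mod_greater_zero_iff_not_dvd)
  also have "totatives p = (\<lambda>i. g ^ i mod p) ` {..<totient p}"
    using residue_primroot_is_generator[OF p_gt_1 g] by (simp add: bij_betw_def)
  finally have "\<exists>i. [g ^ i = n] (mod p)" by (auto simp: Cong.cong_def)
  then show ?thesis unfolding dlog_def by (rule someI_ex)
qed

lemma power_g_cong_iff: "[g ^ i = g ^ j] (mod p) \<longleftrightarrow> [i = j] (mod (p - 1))"
proof -
  have "coprime p g" "ord p g = p - 1"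
    using g p by (auto simp: residue_primroot_def totient_prime)
  then show ?thesis using order_divides_expdiff by metis
qed

lemma not_dvd_power_g: "\<not> p dvd g ^ i"
proof
  assume "p dvd g ^ i"
  then have "p dvd g" using p prime_dvd_power by blast
  moreover have "coprime p g" using g by (simp add: residue_primroot_def)
  ultimately show False using p_gt_1 by (metis coprime_absorb_left nat_dvd_1_iff_1 less_irrefl)
qed

lemma dlog_cong_iff:
  assumes "\<not> p dvd m" "\<not> p dvd n"
  shows "[dlog m = dlog n] (mod (p - 1)) \<longleftrightarrow> [m = n] (mod p)"
  using dlog[OF assms(1)] dlog[OF assms(2)] power_g_cong_iff[of "dlog m" "dlog n"]
  by (metis cong_trans cong_sym)

lemma dlog_power_g: "[dlog (g ^ i) = i] (mod (p - 1))"
  using dlog[OF not_dvd_power_g] power_g_cong_iff by blast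

definition character :: "nat \<Rightarrow> nat \<Rightarrow> complex" where
  "character k n = (if p dvd n then 0 else unity_root (p - 1) (k * dlog n))"

lemma character_eqI:
  assumes "\<not> p dvd n" "[dlog n = i] (mod (p - 1))"
  shows "character k n = unity_root (p - 1) (k * i)"
  using assms p_gt_1 by (simp add: character_def unity_root_cong_iff cong_scalar_left)

lemma character_cong:
  assumes "[m = n] (mod p)"
  shows "character k m = character k n"
proof (cases "p dvd n")
  case True
  then show ?thesis using assms cong_dvd_iff[of m n p] by (simp add: character_def)
next
  case False
  then have "\<not> p dvd m" using assms cong_dvd_iff[of m n p] by simp
  then show ?thesis
    using character_eqI[of m "dlog n" k] dlog_cong_iff[of m n] False assms by (simp add: character_def)
qed

lemma character_mult: "character k (m * n) = character k m * character k n"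
proof (cases "p dvd m \<or> p dvd n")
  case True
  then show ?thesis by (auto simp: character_def)
next
  case False
  then have nd: "\<not> p dvd m" "\<not> p dvd n" "\<not> p dvd m * n" using p by (auto simp: prime_dvd_mult_iff)
  have "[g ^ dlog (m * n) = m * n] (mod p)" by (rule dlog[OF nd(3)])
  moreover have "[g ^ (dlog m + dlog n) = m * n] (mod p)"
    unfolding power_add by (intro cong_mult dlog nd)
  ultimately have "[dlog (m * n) = dlog m + dlog n] (mod (p - 1))"
    using power_g_cong_iff cong_trans cong_sym by metis
  then show ?thesis
    using character_eqI[OF nd(3)] nd by (simp add: character_def distrib_left unity_root_add)
qed

lemma character_1: "character k 1 = 1"
proof -
  have "character k (g ^ 0) = unity_root (p - 1) (k * 0)"
    by (intro character_eqI not_dvd_power_g dlog_power_g)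
  then show ?thesis by simp
qed

lemma character_values: "character k n = 0 \<or> norm (character k n) = 1"
  by (simp add: character_def)

lemma sum_character_period:
  assumes "0 < k" "k < p - 1"
  shows "(\<Sum>n<p. character k n) = 0"
proof -
  have "(\<Sum>n<p. character k n) = (\<Sum>n\<in>totatives p. character k n)"
    unfolding totatives_prime[OF p]
    by (intro sum.mono_neutral_right) (auto simp: character_def)
  also have "\<dots> = (\<Sum>i<p-1. character k (g ^ i mod p))"
    using sum.reindex_bij_betw[OF residue_primroot_is_generator[OF p_gt_1 g], of "character k"]
    by (simp add: totient_prime[OF p])
  also have "\<dots> = (\<Sum>i<p-1. unity_root (p - 1) k ^ i)"
  proof (intro sum.cong refl)
    fix i
    have "character k (g ^ i mod p) = character k (g ^ i)" by (intro character_cong) (simp add: Cong.cong_def)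
    also have "\<dots> = unity_root (p - 1) (k * i)"
      by (intro character_eqI not_dvd_power_g dlog_power_g)
    finally show "character k (g ^ i mod p) = unity_root (p - 1) k ^ i"
      by (simp add: unity_root_mult mult.commute)
  qed
  also have "\<dots> = 0"
  proof (rule sum_powers_eq_0)
    show "unity_root (p - 1) k ^ (p - 1) = 1" using p_gt_1 by (simp add: unity_root_power_self)
    have "\<not> [k = 0] (mod (p - 1))" using assms by (auto simp: cong_0_iff dest: dvd_imp_le)
    then show "unity_root (p - 1) k \<noteq> 1"
      using unity_root_cong_iff[of "p - 1" k 0] p_gt_1 by simp
  qed
  finally show ?thesis .
qed

text \<open>
  Orthogonality: the summands are the powers of one root of unity, which is \<open>1\<close> exactly if \<open>n\<close> and
  \<open>a\<close> have the same discrete logarithm.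
\<close>

lemma sum_characters:
  assumes a: "\<not> p dvd a"
  shows "(\<Sum>k<p-1. cnj (character k a) * character k n) = (if [n = a] (mod p) then of_nat (p - 1) else 0)"
proof (cases "p dvd n")
  case True
  then have "\<not> [n = a] (mod p)" using a cong_dvd_iff by blast
  then show ?thesis using True by (simp add: character_def)
next
  case False
  define w where "w = cnj (unity_root (p - 1) (dlog a)) * unity_root (p - 1) (dlog n)"
  have one: "cnj (unity_root (p - 1) i) * unity_root (p - 1) i = 1" for i
    using complex_norm_square[of "unity_root (p - 1) i"] by (simp add: mult.commute)
  have sum: "(\<Sum>k<p-1. cnj (character k a) * character k n) = (\<Sum>k<p-1. w ^ k)"
    using a False by (intro sum.cong refl) (simp add: character_def unity_root_mult w_def power_mult_distrib)
  have "w = 1 \<longleftrightarrow> unity_root (p - 1) (dlog n) = unity_root (p - 1) (dlog a)"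
    unfolding w_def using one[of "dlog a"] by (metis mult_cancel_left mult_zero_left zero_neq_one)
  also have "\<dots> \<longleftrightarrow> [n = a] (mod p)"
    using p_gt_1 unity_root_cong_iff[of "p - 1"] dlog_cong_iff[OF False a] by simp
  finally have w1: "w = 1 \<longleftrightarrow> [n = a] (mod p)" .
  have "w ^ (p - 1) = 1"
    unfolding w_def power_mult_distrib complex_cnj_power[symmetric] using p_gt_1 by (simp add: unity_root_power_self)
  then show ?thesis unfolding sum using w1 sum_powers_eq_0[of w "p - 1"] by auto
qed

text \<open>
  Conjugation pairs the character \<open>k\<close> with \<open>p - 1 - k\<close>; a nonprincipal character is real only if
  it is its own partner.
\<close>

lemma cnj_character:
  assumes "k \<le> p - 1"
  shows "cnj (character k n) = character (p - 1 - k) n"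
proof (cases "p dvd n")
  case False
  let ?u = "\<lambda>k. unity_root (p - 1) (k * dlog n)"
  have "?u (p - 1 - k) * ?u k = unity_root (p - 1) ((p - 1) * dlog n)"
    unfolding unity_root_add[symmetric] using assms by (metis add_mult_distrib le_add_diff_inverse2)
  also have "\<dots> = 1" using p_gt_1 by (simp add: unity_root_mult unity_root_power_self)
  finally have "?u (p - 1 - k) * ?u k = cnj (?u k) * ?u k"
    using complex_norm_square[of "?u k"] by (simp add: mult.commute)
  then have "?u (p - 1 - k) = cnj (?u k)"
    by (metis mult_cancel_right norm_unity_root norm_zero zero_neq_one)
  then show ?thesis using False by (simp add: character_def)
qed (simp add: character_def)

lemma nonprincipal_oscillating:
  assumes "0 < k" "k < p - 1"
  shows "oscillating_multiplicative (character k) (2 * real p)"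
proof
  show "norm (\<Sum>n=a..b. character k n) \<le> 2 * real p" for a b
  proof (rule norm_sum_periodic_le)
    show "character k (n + p) = character k n" for n
      by (rule character_cong) (simp add: Cong.cong_def)
    show "norm (character k n) \<le> 1" for n using character_values[of k n] by auto
  qed (use sum_character_period[OF assms] p_gt_1 in auto)
qed (use character_mult character_1 character_values in auto)

abbreviation L :: "nat \<Rightarrow> complex" where
  "L k \<equiv> oscillating_multiplicative.L (character k)"

definition S :: "nat \<Rightarrow> nat \<Rightarrow> complex" where
  "S k X = (\<Sum>n=1..X. character k n * mangoldt n / of_nat n)"

lemma L_complement:
  assumes "0 < k" "k < p - 1"
  shows "L (p - 1 - k) = cnj (L k)"
proof -
  interpret A: oscillating_multiplicative "character k" "2 * real p"
    by (rule nonprincipal_oscillating) (use assms in auto)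
  interpret B: oscillating_multiplicative "character (p - 1 - k)" "2 * real p"
    by (rule nonprincipal_oscillating) (use assms in auto)
  have "B.F = (\<lambda>N. cnj (A.F N))"
    using cnj_character[of k] assms
    by (intro ext) (simp only: A.F_def B.F_def cnj_sum complex_cnj_divide complex_cnj_of_nat less_imp_le)
  moreover have "(\<lambda>N. cnj (A.F N)) \<longlonglongrightarrow> cnj (L k)"
    by (intro tendsto_cnj A.F_tendsto)
  ultimately show ?thesis using B.F_tendsto LIMSEQ_unique by metis
qed

text \<open>
  Both alternatives for \<open>L\<close> as a single upper bound, in the shape in which it is summed over all
  characters.
\<close>

lemma S_Re_le:
  assumes "0 < k" "k < p - 1"
  shows "\<exists>B. \<forall>X>0. Re (S k X) \<le> B - (if L k = 0 then ln (real X) else 0)"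
proof -
  interpret A: oscillating_multiplicative "character k" "2 * real p"
    by (rule nonprincipal_oscillating) (use assms in auto)
  have S: "S k X = A.S X" for X by (simp add: S_def A.S_def)
  show ?thesis
  proof (cases "L k = 0")
    case True
    then obtain B where B: "\<And>X. X > 0 \<Longrightarrow> norm (A.S X + of_real (ln (real X))) \<le> B"
      using A.S_near_minus_ln_if_L_zero by blast
    have "Re (S k X) \<le> B - ln (real X)" if "X > 0" for X
      using B[OF that] complex_Re_le_cmod[of "A.S X + of_real (ln (real X))"] by (simp add: S)
    then show ?thesis using True by auto
  next
    case False
    then obtain B where B: "\<And>X. norm (A.S X) \<le> B" using A.S_bounded_if_L_nonzero by blast
    have "Re (S k X) \<le> B" for X
      using B[of X] complex_Re_le_cmod[of "A.S X"] by (simp add: S)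
    then show ?thesis using False by auto
  qed
qed

lemma sum_S:
  assumes "\<not> p dvd a"
  shows "(\<Sum>k<p-1. cnj (character k a) * S k X) = of_real (real (p - 1) * mangoldt_weight (\<lambda>n. [n = a] (mod p)) X)"
proof -
  have "(\<Sum>k<p-1. cnj (character k a) * S k X)
      = (\<Sum>n=1..X. (\<Sum>k<p-1. cnj (character k a) * character k n) * (mangoldt n / of_nat n))"
    unfolding S_def sum_distrib_left sum_distrib_right by (subst sum.swap) (simp add: mult_ac)
  also have "\<dots> = (\<Sum>n=1..X. if [n = a] (mod p) then of_nat (p - 1) * (mangoldt n / of_nat n) else 0)"
    unfolding sum_characters[OF assms] by (intro sum.cong refl) auto
  also have "\<dots> = of_real (real (p - 1) * mangoldt_weight (\<lambda>n. [n = a] (mod p)) X)"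
    unfolding mangoldt_weight_def sum_distrib_left of_real_sum
    by (intro sum.mono_neutral_cong_right) auto
  finally show ?thesis .
qed

lemma S_0: "S 0 X = of_real (mangoldt_weight (\<lambda>n. \<not> p dvd n) X)"
  unfolding S_def mangoldt_weight_def of_real_sum
  by (intro sum.mono_neutral_cong_right) (auto simp: character_def)

text \<open>
  Summed over all characters, \<open>S k X\<close> gives a nonnegative quantity. The principal character
  contributes at most \<open>ln X + 4\<close>, each zero of \<open>L\<close> contributes \<open>- ln X + O(1)\<close>, and the remaining
  characters are bounded. Two zeros would make the total negative for large \<open>X\<close>.
\<close>

lemma at_most_one_L_zero: "card {k \<in> {1..<p-1}. L k = 0} \<le> 1"
proof (rule ccontr)
  let ?Z = "{k \<in> {1..<p-1}. L k = 0}"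
  assume "\<not> card ?Z \<le> 1"
  then have Z: "card ?Z \<ge> 2" by simp
  have "\<forall>k\<in>{1..<p-1}. \<exists>B. \<forall>X>0. Re (S k X) \<le> B - (if L k = 0 then ln (real X) else 0)"
    using S_Re_le by auto
  then obtain B where B: "\<And>k X. k \<in> {1..<p-1} \<Longrightarrow> X > 0 \<Longrightarrow>
      Re (S k X) \<le> B k - (if L k = 0 then ln (real X) else 0)"
    by (metis (no_types, lifting) bchoice)
  have bd: "ln (real X) \<le> 4 + (\<Sum>k\<in>{1..<p-1}. B k)" if X: "X > 0" for X :: nat
  proof -
    have "0 \<le> real (p - 1) * mangoldt_weight (\<lambda>n. [n = 1] (mod p)) X"
      by (intro mult_nonneg_nonneg mangoldt_weight_nonneg) auto
    also have "\<dots> = Re (\<Sum>k<p-1. S k X)"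
      using sum_S[of 1 X] p_gt_1 by (simp only: character_1) simp
    also have "{..<p-1} = insert 0 {1..<p-1}" using p_gt_1 by auto
    also have "Re (\<Sum>k\<in>insert 0 {1..<p-1}. S k X) = Re (S 0 X) + (\<Sum>k\<in>{1..<p-1}. Re (S k X))"
      by simp
    also have "\<dots> \<le> (ln (real X) + 4) + (\<Sum>k\<in>{1..<p-1}. B k - (if L k = 0 then ln (real X) else 0))"
      using mangoldt_weight_le_ln[OF X] X by (intro add_mono sum_mono B) (auto simp: S_0)
    also have "(\<Sum>k\<in>{1..<p-1}. B k - (if L k = 0 then ln (real X) else 0))
        = (\<Sum>k\<in>{1..<p-1}. B k) - real (card ?Z) * ln (real X)"
      by (simp add: sum_subtractf sum.If_cases Int_def)
    finally have "0 \<le> ln (real X) + 4 + ((\<Sum>k\<in>{1..<p-1}. B k) - real (card ?Z) * ln (real X))" .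
    moreover have "2 * ln (real X) \<le> real (card ?Z) * ln (real X)"
      using Z X by (intro mult_right_mono) auto
    ultimately show ?thesis by linarith
  qed
  obtain X :: nat where X: "real X > exp (4 + (\<Sum>k\<in>{1..<p-1}. B k))" using reals_Archimedean2 by blast
  then have pos: "real X > 0" using exp_gt_zero less_trans by blast
  have "ln (exp (4 + (\<Sum>k\<in>{1..<p-1}. B k))) < ln (real X)"
    using X pos by (subst ln_less_cancel_iff) auto
  then show False using bd[of X] pos by simp
qed

theorem L_nonzero:
  assumes k: "0 < k" "k < p - 1"
  shows "L k \<noteq> 0"
proof
  assume zero: "L k = 0"
  interpret A: oscillating_multiplicative "character k" "2 * real p"
    by (rule nonprincipal_oscillating) (use k in auto)
  have "L (p - 1 - k) = 0" using L_complement[OF k] zero by simp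
  then have sub: "{k, p - 1 - k} \<subseteq> {k \<in> {1..<p-1}. L k = 0}" using k zero by auto
  then have "card {k, p - 1 - k} \<le> 1"
    using card_mono[OF _ sub] at_most_one_L_zero by fastforce
  then have "p - 1 - k = k" by (auto simp: card_insert_if split: if_splits)
  then have "character k n \<in> \<real>" for n
    using cnj_character[of k n] k by (simp add: Reals_cnj_iff)
  then show False using A.L_nonzero_if_real zero by blast
qed

lemma S_bounded:
  assumes "0 < k" "k < p - 1"
  shows "\<exists>B. \<forall>X. norm (S k X) \<le> B"
proof -
  interpret A: oscillating_multiplicative "character k" "2 * real p"
    by (rule nonprincipal_oscillating) (use assms in auto)
  show ?thesis
    using A.S_bounded_if_L_nonzero[OF L_nonzero[OF assms]] by (simp add: S_def A.S_def)
qed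

text \<open>
  In the orthogonality relation only the principal character has an unbounded contribution.
\<close>

lemma mangoldt_weight_residue_class:
  assumes a: "\<not> p dvd a"
  shows "\<exists>B. \<forall>X. \<bar>real (p - 1) * mangoldt_weight (\<lambda>n. [n = a] (mod p)) X 
     - mangoldt_weight (\<lambda>n. \<not> p dvd n) X\<bar> \<le> B"
proof -
  have "\<forall>k\<in>{1..<p-1}. \<exists>B. \<forall>X. norm (S k X) \<le> B" using S_bounded by auto
  then obtain B where B: "\<And>k X. k \<in> {1..<p-1} \<Longrightarrow> norm (S k X) \<le> B k"
    by (metis (no_types, lifting) bchoice)
  have "\<bar>real (p - 1) * mangoldt_weight (\<lambda>n. [n = a] (mod p)) X 
     - mangoldt_weight (\<lambda>n. \<not> p dvd n) X\<bar> \<le> (\<Sum>k\<in>{1..<p-1}. B k)" for X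
  proof -
    have set: "{..<p-1} = insert 0 {1..<p-1}" using p_gt_1 by auto
    have "of_real (real (p - 1) * mangoldt_weight (\<lambda>n. [n = a] (mod p)) X)
        = S 0 X + (\<Sum>k\<in>{1..<p-1}. cnj (character k a) * S k X)"
      unfolding sum_S[OF a, symmetric] set using a by (simp add: character_def)
    then have "complex_of_real (real (p - 1) * mangoldt_weight (\<lambda>n. [n = a] (mod p)) X 
        - mangoldt_weight (\<lambda>n. \<not> p dvd n) X) = (\<Sum>k\<in>{1..<p-1}. cnj (character k a) * S k X)"
      by (simp only: S_0 of_real_diff) simp
    then have "\<bar>real (p - 1) * mangoldt_weight (\<lambda>n. [n = a] (mod p)) X 
        - mangoldt_weight (\<lambda>n. \<not> p dvd n) X\<bar> = norm (\<Sum>k\<in>{1..<p-1}. cnj (character k a) * S k X)"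
      by (metis norm_of_real)
    also have "\<dots> \<le> (\<Sum>k\<in>{1..<p-1}. B k)"
    proof (rule sum_norm_le)
      fix k assume "k \<in> {1..<p-1}"
      then show "norm (cnj (character k a) * S k X) \<le> B k"
        using B[of k X] character_values[of k a] by (auto simp: norm_mult intro: order.trans[OF norm_ge_zero])
    qed
    finally show ?thesis .
  qed
  then show ?thesis by blast
qed

end

section \<open>Equidistribution of the primes modulo a prime\<close>

abbreviation prime_weight :: "(nat \<Rightarrow> bool) \<Rightarrow> nat \<Rightarrow> real" where
  "prime_weight P \<equiv> mangoldt_weight (\<lambda>n. P n \<and> prime n)"

lemma prime_weight_close:
  "\<exists>C. \<forall>P X. \<bar>mangoldt_weight P X - prime_weight P X\<bar> \<le> C"
proof -
  obtain C where C: "\<And>X. mangoldt_weight (\<lambda>n. \<not> prime n) X \<le> C"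
    using mangoldt_weight_nonprime_bounded by blast
  have "\<bar>mangoldt_weight P X - prime_weight P X\<bar> \<le> C" for P X
    using mangoldt_weight_split[of P X prime] mangoldt_weight_nonneg[of "\<lambda>n. P n \<and> \<not> prime n" X]
      mangoldt_weight_mono[of "\<lambda>n. P n \<and> \<not> prime n" "\<lambda>n. \<not> prime n" X] C[of X] by auto
  then show ?thesis by blast
qed

lemma prime_weight_multiples_le:
  assumes "prime p"
  shows "prime_weight (\<lambda>n. p dvd n) X \<le> mangoldt p / real p"
proof -
  have "prime_weight (\<lambda>n. p dvd n) X \<le> (\<Sum>n\<in>{p}. mangoldt n / real n)"
    unfolding mangoldt_weight_def using assms prime_ge_1_nat[OF assms]
    by (intro sum_mono2) (auto simp: mangoldt_nonneg dest: primes_dvd_imp_eq)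
  then show ?thesis by simp
qed

text \<open>
  Passing from prime powers to primes, and from all \<open>n\<close> to those prime to \<open>p\<close>, changes the weights
  by bounded amounts.
\<close>

theorem prime_weight_equidistributed:
  assumes p: "prime p" and a: "\<not> p dvd a"
  shows "\<exists>B. \<forall>X. \<bar>real (p - 1) * prime_weight (\<lambda>n. [n = a] (mod p)) X - prime_weight (\<lambda>_. True) X\<bar> \<le> B"
proof -
  obtain g where "residue_primroot p g" using primitive_root_exists[OF p] .
  then interpret prime_modulus p g using p by unfold_locales
  obtain B where B: "\<And>X. \<bar>real (p - 1) * mangoldt_weight (\<lambda>n. [n = a] (mod p)) X 
     - mangoldt_weight (\<lambda>n. \<not> p dvd n) X\<bar> \<le> B"
    using mangoldt_weight_residue_class[OF a] by blast
  obtain C where C: "\<And>P X. \<bar>mangoldt_weight P X - prime_weight P X\<bar> \<le> C"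
    using prime_weight_close by blast
  have "\<bar>real (p - 1) * prime_weight (\<lambda>n. [n = a] (mod p)) X - prime_weight (\<lambda>_. True) X\<bar> 
      \<le> real (p - 1) * C + B + C + mangoldt p / real p" for X
  proof -
    let ?A = "mangoldt_weight (\<lambda>n. [n = a] (mod p)) X" and ?A' = "prime_weight (\<lambda>n. [n = a] (mod p)) X"
    have "\<bar>real (p - 1) * ?A - real (p - 1) * ?A'\<bar> \<le> real (p - 1) * C"
      unfolding right_diff_distrib[symmetric] abs_mult using C by (auto intro!: mult_left_mono)
    moreover have "prime_weight (\<lambda>_. True) X 
       = prime_weight (\<lambda>n. p dvd n) X + prime_weight (\<lambda>n. \<not> p dvd n) X"
      using mangoldt_weight_split[of "\<lambda>n. True \<and> prime n" X "\<lambda>n. p dvd n"] by (simp add: conj_commute)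
    moreover note C[of "\<lambda>n. \<not> p dvd n" X] prime_weight_multiples_le[OF p, of X] B[of X]
      mangoldt_weight_nonneg[of "\<lambda>n. p dvd n \<and> prime n" X]
    ultimately show ?thesis by linarith
  qed
  then show ?thesis by blast
qed

lemma prime_weight_at_top: "filterlim (prime_weight (\<lambda>_. True)) at_top sequentially"
proof -
  obtain C where C: "\<And>P X. \<bar>mangoldt_weight P X - prime_weight P X\<bar> \<le> C"
    using prime_weight_close by blast
  show ?thesis
  proof (rule filterlim_at_top_mono)
    show "filterlim (\<lambda>X. ln (real X) + (- 1 - C)) at_top sequentially"
      by real_asymp
    show "eventually (\<lambda>X. ln (real X) + (- 1 - C) \<le> prime_weight (\<lambda>_. True) X) sequentially"
      using eventually_gt_at_top[of 0]
    proof eventually_elim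
      case (elim X)
      have "ln (real X) - 1 \<le> mangoldt_weight (\<lambda>_. True) X"
        unfolding mangoldt_weight_True by (rule sum_mangoldt_over_bounds(2)[OF elim])
      then show ?case using C[of "\<lambda>_. True" X] by linarith
    qed
  qed
qed

section \<open>Charges as limits of probabilities\<close>

text \<open>
  A cluster point of the sequence in the compact cube of functions from sets to \<open>[0,1]\<close>. It inherits
  the defining equations of a charge, as these are closed conditions on finitely many coordinates,
  and it agrees with every coordinatewise limit that happens to exist.
\<close>

lemma limit_charge_exists:
  fixes m :: "nat \<Rightarrow> 'a set \<Rightarrow> real"
  assumes m: "\<And>n. probability_charge (m n)"
  shows "\<exists>\<mu>. probability_charge \<mu> \<and> (\<forall>A c. (\<lambda>n. m n A) \<longlonglongrightarrow> c \<longrightarrow> \<mu> A = c)"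
proof -
  define K :: "('a set \<Rightarrow> real) set" where "K = PiE UNIV (\<lambda>_. {0..1})"
  have "compactin (product_topology (\<lambda>_. euclidean) UNIV) K"
    unfolding K_def by (subst compactin_PiE) auto
  then have "compact K" by (simp add: euclidean_product_topology)
  have range: "0 \<le> m n A \<and> m n A \<le> 1" for n A
  proof -
    have "m n (A \<union> - A) = m n A + m n (- A)"
      using m[of n] unfolding probability_charge_def by blast
    then have "m n A + m n (- A) = 1" using m[of n] by (simp add: probability_charge_def)
    moreover have "0 \<le> m n A" "0 \<le> m n (- A)" using m[of n] by (simp_all add: probability_charge_def)
    ultimately show ?thesis by linarith
  qed
  have "eventually (\<lambda>\<mu>. \<mu> \<in> K) (filtermap m sequentially)"
    unfolding eventually_filtermap K_def using range by (intro always_eventually) (auto simp: PiE_iff)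
  moreover have "filtermap m sequentially \<noteq> bot" by (simp add: filtermap_bot_iff)
  ultimately obtain \<mu> where \<mu>: "\<mu> \<in> K" "inf (nhds \<mu>) (filtermap m sequentially) \<noteq> bot"
    using \<open>compact K\<close> unfolding compact_filter by blast
  let ?G = "inf (nhds \<mu>) (filtermap m sequentially)"
  have lim: "h \<mu> = c" if h: "continuous_on UNIV h" "(\<lambda>n. h (m n)) \<longlonglongrightarrow> c" for h :: "('a set \<Rightarrow> real) \<Rightarrow> real" and c
  proof -
    have "(h \<longlongrightarrow> h \<mu>) (nhds \<mu>)"
      using h(1) by (simp add: continuous_on_def tendsto_at_iff_tendsto_nhds)
    then have "(h \<longlongrightarrow> h \<mu>) ?G" by (rule tendsto_mono[rotated]) simp
    moreover have "(h \<longlongrightarrow> c) (filtermap m sequentially)"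
      using h(2) by (simp add: filterlim_filtermap)
    then have "(h \<longlongrightarrow> c) ?G" by (rule tendsto_mono[rotated]) simp
    ultimately show ?thesis using tendsto_unique \<mu>(2) by blast
  qed
  have coord: "continuous_on UNIV (\<lambda>\<mu>. \<mu> A)" for A :: "'a set"
    by (rule continuous_on_product_coordinates)
  have "probability_charge \<mu>"
    unfolding probability_charge_def
  proof (intro conjI allI impI)
    show "0 \<le> \<mu> A" for A using \<mu>(1) by (auto simp: K_def PiE_def Pi_def)
    show "\<mu> UNIV = 1" 
      using m by (intro lim[of "\<lambda>\<mu>. \<mu> UNIV"] coord) (simp add: probability_charge_def)
    fix A B :: "'a set" assume AB: "A \<inter> B = {}"
    have "\<mu> (A \<union> B) - \<mu> A - \<mu> B = 0"
      using m AB by (intro lim[of "\<lambda>\<mu>. \<mu> (A \<union> B) - \<mu> A - \<mu> B"] continuous_intros coord) 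
        (simp add: probability_charge_def)
    then show "\<mu> (A \<union> B) = \<mu> A + \<mu> B" by simp
  qed
  then show ?thesis using lim coord by blast
qed

lemma probability_charge_pmf: "probability_charge (measure (measure_pmf Q))"
  unfolding probability_charge_def
  by (auto simp: measure_pmf.finite_measure_Union measure_pmf.prob_space[simplified])

lemma probability_charge_convex:
  assumes "probability_charge \<mu>" "probability_charge \<nu>" "0 \<le> t" "t \<le> 1"
  shows "probability_charge (\<lambda>A. t * \<mu> A + (1 - t) * \<nu> A)"
  unfolding probability_charge_def
proof (intro conjI allI impI)
  show "0 \<le> t * \<mu> A + (1 - t) * \<nu> A" for A
    using assms by (auto simp: probability_charge_def)
qed (use assms in \<open>auto simp: probability_charge_def algebra_simps\<close>)

section \<open>Prescribing residues modulo finitely many primes\<close>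

text \<open>
  To add a prime \<open>p\<close>, draw the old integer and a residue modulo \<open>p\<close> independently and combine them
  by the Chinese remainder theorem. Negative representatives keep the law away from the primes.
\<close>

lemma exists_negative_pmf_with_residue_laws:
  fixes law :: "nat \<Rightarrow> int pmf"
  assumes "finite P" "\<And>p. p \<in> P \<Longrightarrow> prime p"
  shows "\<exists>Q. set_pmf Q \<subseteq> {..<0} \<and> (\<forall>p\<in>P. \<forall>j. 
    measure_pmf.prob Q {z. [z = j] (mod int p)} = measure_pmf.prob (law p) {z. [z = j] (mod int p)})"
  using assms
proof (induction P rule: finite_induct)
  case empty
  then show ?case by (auto intro!: exI[of _ "return_pmf (-1)"])
next
  case (insert p P)
  then obtain Q where Q: "set_pmf Q \<subseteq> {..<0}"
    "\<And>q j. q \<in> P \<Longrightarrow> measure_pmf.prob Q {z. [z = j] (mod int q)} = measure_pmf.prob (law q) {z. [z = j] (mod int q)}"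
    by auto
  define M where "M = int (\<Prod>P)"
  have p: "prime p" and P: "\<And>q. q \<in> P \<Longrightarrow> prime q" using insert.prems by auto
  have "coprime (\<Prod>P) p"
    using p P insert.hyps by (intro prod_coprime_left) (metis primes_coprime)
  then have cop: "coprime M (int p)" unfolding M_def by (simp only: coprime_int_iff)
  have "\<Prod>P > 0" using P by (intro prod_pos) (auto simp: prime_gt_0_nat)
  then have "M > 0" unfolding M_def by (simp only: of_nat_0_less_iff)
  then have "M * int p > 0" using p by (simp add: prime_gt_0_nat)
  then have pos: "M * int p \<ge> 1" by linarith
  have "\<exists>z<0. [z = x] (mod M) \<and> [z = y] (mod int p)" for x y
  proof -
    obtain z where z: "[z = x] (mod M)" "[z = y] (mod int p)"
      using binary_chinese_remainder_int[OF cop] by blast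
    \<comment> \<open>subtract a multiple of the modulus that is large enough to make the representative negative\<close>
    let ?z = "z - (\<bar>z\<bar> + 1) * (M * int p)"
    have "(\<bar>z\<bar> + 1) * (M * int p) \<ge> (\<bar>z\<bar> + 1) * 1" using pos by (intro mult_left_mono) auto
    then have "?z \<le> z - (\<bar>z\<bar> + 1)" unfolding mult_1_right by (rule diff_left_mono)
    also have "\<dots> < 0" by simp
    finally have "?z < 0" .
    moreover have "[?z = z] (mod M)" "[?z = z] (mod int p)"
      by (auto simp: cong_iff_dvd_diff)
    ultimately show ?thesis using z cong_trans by blast
  qed
  then obtain f where f: "\<And>x y. f x y < 0" "\<And>x y. [f x y = x] (mod M)" "\<And>x y. [f x y = y] (mod int p)"
    by metis
  define R where "R = map_pmf (\<lambda>(x, y). f x y) (pair_pmf Q (law p))"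
  have R1: "measure_pmf.prob R {z. [z = j] (mod int p)} = measure_pmf.prob (law p) {z. [z = j] (mod int p)}" for j
  proof -
    have cong_f: "[f x y = j] (mod int p) \<longleftrightarrow> [y = j] (mod int p)" for x y
      using f(3)[of x y] by (metis cong_trans cong_sym)
    have "measure_pmf.prob R {z. [z = j] (mod int p)} = measure_pmf.prob (pair_pmf Q (law p)) (snd -` {z. [z = j] (mod int p)})"
      unfolding R_def measure_map_pmf by (simp add: vimage_def case_prod_unfold cong_f)
    also have "\<dots> = measure_pmf.prob (map_pmf snd (pair_pmf Q (law p))) {z. [z = j] (mod int p)}"
      by (rule measure_map_pmf[symmetric])
    finally show ?thesis by (simp add: map_snd_pair_pmf)
  qed
  have R2: "measure_pmf.prob R {z. [z = j] (mod int q)} = measure_pmf.prob Q {z. [z = j] (mod int q)}" if q: "q \<in> P" for q j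
  proof -
    have "int q dvd M" unfolding M_def using q insert.hyps(1) by (simp add: dvd_prodI)
    then have f2: "[f x y = x] (mod int q)" for x y using f(2) cong_dvd_modulus by blast
    have cong_f: "[f x y = j] (mod int q) \<longleftrightarrow> [x = j] (mod int q)" for x y
      using f2[of x y] by (metis cong_trans cong_sym)
    have "measure_pmf.prob R {z. [z = j] (mod int q)} = measure_pmf.prob (pair_pmf Q (law p)) (fst -` {z. [z = j] (mod int q)})"
      unfolding R_def measure_map_pmf by (simp add: vimage_def case_prod_unfold cong_f)
    also have "\<dots> = measure_pmf.prob (map_pmf fst (pair_pmf Q (law p))) {z. [z = j] (mod int q)}"
      by (rule measure_map_pmf[symmetric])
    finally show ?thesis by (simp add: map_fst_pair_pmf)
  qed
  have "set_pmf R \<subseteq> {..<0}" using f(1) by (auto simp: R_def)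
  then show ?case using R1 R2 Q(2) by (intro exI[of _ R]) auto
qed

definition uniform_law :: "nat \<Rightarrow> int pmf" where
  "uniform_law p = pmf_of_set {0..<int p}"

text \<open>
  The mixture of the uniform law on the residues, of weight \<open>(p-2)/(p-1)\<close>, with the point mass at
  \<open>0\<close>, of weight \<open>1/(p-1)\<close>: the value \<open>k = 0\<close> of a second independent uniform variable selects the
  point mass. For \<open>p = 2\<close> only the point mass is left.
\<close>

definition compensating_law :: "nat \<Rightarrow> int pmf" where
  "compensating_law p = map_pmf (\<lambda>(i, k). if k = 0 then 0 else i)
     (pmf_of_set ({0..<int p} \<times> {0..<p - 1}))"

lemma prob_uniform_law:
  assumes "p > 0"
  shows "measure_pmf.prob (uniform_law p) {z. [z = j] (mod int p)} = 1 / real p"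
proof -
  have "{0..<int p} \<inter> {z. [z = j] (mod int p)} = {j mod int p}"
    using assms by (auto simp: Cong.cong_def)
  then show ?thesis using assms by (simp add: uniform_law_def measure_pmf_of_set)
qed

lemma prob_compensating_law:
  assumes p: "p > 1"
  shows "measure_pmf.prob (compensating_law p) {z. [z = j] (mod int p)} = 
    (if int p dvd j then 2 / real p else real (p - 2) / (real p * real (p - 1)))"
proof -
  let ?S = "{0..<int p} \<times> {0..<p - 1}"
  let ?A = "(\<lambda>(i, k). if k = 0 then 0 else i) -` {z. [z = j] (mod int p)}"
  have "measure_pmf.prob (compensating_law p) {z. [z = j] (mod int p)} = real (card (?S \<inter> ?A)) / real (card ?S)"
    unfolding compensating_law_def measure_map_pmf using p by (subst measure_pmf_of_set) auto
  also have "card ?S = p * (p - 1)" by simp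
  also have "card (?S \<inter> ?A) = (if int p dvd j then 2 * (p - 1) else p - 2)"
  proof (cases "int p dvd j")
    case True
    have "a = 0" if "0 \<le> a" "a < int p" "int p dvd a" for a
      using that zdvd_not_zless[of a "int p"] by linarith
    with True have "?S \<inter> ?A = {0} \<times> {1..<p-1} \<union> {0..<int p} \<times> {0}"
      using p by (auto simp: Cong.cong_def mod_eq_0_iff_dvd split: if_splits)
    also have "card \<dots> = (p - 2) + p"
      using p by (subst card_Un_disjoint) auto
    finally show ?thesis using True p by simp
  next
    case False
    then have "j mod int p \<noteq> 0" by (simp add: dvd_eq_mod_eq_0)
    then have "?S \<inter> ?A = {j mod int p} \<times> {1..<p-1}"
      using p by (auto simp: Cong.cong_def split: if_splits)
    also have "card \<dots> = p - 2" by simp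
    finally show ?thesis using False by simp
  qed
  finally have "measure_pmf.prob (compensating_law p) {z. [z = j] (mod int p)} =
      real (if int p dvd j then 2 * (p - 1) else p - 2) / (real p * real (p - 1))"
    by (simp only: of_nat_mult)
  moreover have "real (2 * (p - 1)) / (real p * real (p - 1)) = 2 / real p"
    unfolding of_nat_mult of_nat_numeral using p by (intro mult_divide_mult_cancel_right) simp
  ultimately show ?thesis by (simp only: split: if_split) blast
qed

lemma prob_primes_int_eq_0:
  assumes "set_pmf Q \<subseteq> {..<0}"
  shows "measure_pmf.prob Q primes_int = 0"
proof -
  have "x \<notin> primes_int" if "x \<in> set_pmf Q" for x
  proof -
    have "x < 0" using assms that by blast
    then show ?thesis using prime_gt_0_int[of x] by (auto simp: primes_int_def)
  qed
  then show ?thesis by (auto simp: measure_pmf_zero_iff)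
qed

lemma negative_pmfs_with_limit_laws:
  "\<exists>Q :: nat \<Rightarrow> int pmf. (\<forall>n. set_pmf (Q n) \<subseteq> {..<0}) \<and>
     (\<forall>p j. prime p \<longrightarrow> (\<lambda>n. measure_pmf.prob (Q n) {z. [z = j] (mod int p)}) 
        \<longlonglongrightarrow> measure_pmf.prob (law p) {z. [z = j] (mod int p)})"
proof -
  have "\<forall>n. \<exists>Q. set_pmf Q \<subseteq> {..<0} \<and> (\<forall>p\<in>{p. prime p \<and> p \<le> n}. \<forall>j. 
    measure_pmf.prob Q {z. [z = j] (mod int p)} = measure_pmf.prob (law p) {z. [z = j] (mod int p)})"
    by (intro allI exists_negative_pmf_with_residue_laws) auto
  from choice[OF this] obtain Q where Q: "\<forall>n. set_pmf (Q n) \<subseteq> {..<0} \<and> 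
    (\<forall>p\<in>{p. prime p \<and> p \<le> n}. \<forall>j. measure_pmf.prob (Q n) {z. [z = j] (mod int p)} 
      = measure_pmf.prob (law p) {z. [z = j] (mod int p)})" ..
  show ?thesis
  proof (intro exI[of _ Q] conjI allI impI)
    show "set_pmf (Q n) \<subseteq> {..<0}" for n using Q by blast
    fix p j assume p: "prime (p :: nat)"
    have "measure_pmf.prob (Q n) {z. [z = j] (mod int p)} 
      = measure_pmf.prob (law p) {z. [z = j] (mod int p)}" if "n \<ge> p" for n
      using Q p that by blast
    then show "(\<lambda>n. measure_pmf.prob (Q n) {z. [z = j] (mod int p)}) 
        \<longlonglongrightarrow> measure_pmf.prob (law p) {z. [z = j] (mod int p)}"
      by (intro tendsto_eventually eventually_sequentiallyI[of p])
  qed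
qed

section \<open>The range of the mass of the primes\<close>

lemma prime_int_iff_nat: "prime (p :: int) \<longleftrightarrow> (\<exists>q. p = int q \<and> prime q)"
proof
  assume "prime p"
  then have "0 \<le> p" "prime (nat p)" using prime_int_nat_transfer by blast+
  then show "\<exists>q. p = int q \<and> prime q" by (metis int_nat_eq)
next
  assume "\<exists>q. p = int q \<and> prime q"
  then show "prime p" by (metis prime_nat_int_transfer)
qed

lemma PR_I:
  assumes "probability_charge \<mu>"
    and "\<And>p j. prime p \<Longrightarrow> \<mu> {z. [z = j] (mod int p)} = 1 / real p"
  shows "\<mu> \<in> PR"
  using assms unfolding PR_def by (auto simp: prime_int_iff_nat)

lemma PR_charge_without_primes: "\<exists>\<mu>\<in>PR. \<mu> primes_int = 0"
proof -
  obtain Q :: "nat \<Rightarrow> int pmf" where Q: "\<And>n. set_pmf (Q n) \<subseteq> {..<0}"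
    "\<And>p j. prime p \<Longrightarrow> (\<lambda>n. measure_pmf.prob (Q n) {z. [z = j] (mod int p)}) 
        \<longlonglongrightarrow> measure_pmf.prob (uniform_law p) {z. [z = j] (mod int p)}"
    using negative_pmfs_with_limit_laws[of uniform_law] by blast
  obtain \<mu> where \<mu>: "probability_charge \<mu>" 
      "\<And>A c. (\<lambda>n. measure_pmf.prob (Q n) A) \<longlonglongrightarrow> c \<Longrightarrow> \<mu> A = c"
    using limit_charge_exists[of "\<lambda>n. measure (measure_pmf (Q n))"] probability_charge_pmf by blast
  have "\<mu> {z. [z = j] (mod int p)} = 1 / real p" if "prime p" for p j
    using \<mu>(2)[OF Q(2)[OF that]] prob_uniform_law[of p j] that by (simp add: prime_gt_0_nat)
  moreover have "\<mu> primes_int = 0"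
    by (rule \<mu>(2)) (simp add: prob_primes_int_eq_0[OF Q(1)])
  ultimately show ?thesis using PR_I[OF \<mu>(1)] by blast
qed

text \<open>
  The probability on the primes up to \<open>X\<close> whose weights are proportional to \<open>ln q / q\<close>.
\<close>

definition prime_density :: "nat \<Rightarrow> int set \<Rightarrow> real" where
  "prime_density X A = prime_weight (\<lambda>n. int n \<in> A) X / prime_weight (\<lambda>_. True) X"

lemma prime_weight_pos:
  assumes "X \<ge> 2"
  shows "prime_weight (\<lambda>_. True) X > 0"
proof -
  have "0 < (\<Sum>n\<in>{2::nat}. mangoldt n / real n :: real)" by simp
  also have "\<dots> \<le> prime_weight (\<lambda>_. True) X"
    unfolding mangoldt_weight_def using assms
    by (intro sum_mono2) (auto intro!: divide_nonneg_nonneg mangoldt_nonneg)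
  finally show ?thesis .
qed

lemma probability_charge_prime_density:
  assumes "X \<ge> 2"
  shows "probability_charge (prime_density X)"
  unfolding probability_charge_def
proof (intro conjI allI impI)
  note pos = prime_weight_pos[OF assms]
  show "0 \<le> prime_density X A" for A
    unfolding prime_density_def by (intro divide_nonneg_nonneg mangoldt_weight_nonneg)
  show "prime_density X UNIV = 1" using pos by (simp add: prime_density_def)
  fix A B :: "int set" assume AB: "A \<inter> B = {}"
  have "prime_weight (\<lambda>n. int n \<in> A \<union> B) X = prime_weight (\<lambda>n. int n \<in> A) X + prime_weight (\<lambda>n. int n \<in> B) X"
    unfolding mangoldt_weight_def using AB
    by (subst sum.union_disjoint[symmetric]) (auto intro!: sum.cong)
  then show "prime_density X (A \<union> B) = prime_density X A + prime_density X B"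
    by (simp add: prime_density_def add_divide_distrib)
qed

lemma prime_density_primes_int:
  assumes "X \<ge> 2"
  shows "prime_density X primes_int = 1"
proof -
  have "(int n \<in> primes_int \<and> prime n) = (True \<and> prime n)" for n by (simp add: primes_int_def)
  then show ?thesis using prime_weight_pos[OF assms] by (simp add: prime_density_def)
qed

text \<open>
  The deviations from equidistribution are bounded, whereas the total weight of the primes tends
  to infinity.
\<close>

lemma prime_density_residue_class_tendsto:
  assumes p: "prime p"
  shows "(\<lambda>X. prime_density X {z. [z = j] (mod int p)}) 
    \<longlonglongrightarrow> (if int p dvd j then 0 else 1 / real (p - 1))"
proof -
  let ?V = "prime_weight (\<lambda>_. True)"
  define a where "a = nat (j mod int p)"
  have p1: "p > 1" using p by (rule prime_gt_1_nat)
  have a_int: "int a = j mod int p" using p1 by (simp add: a_def)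
  have mem: "[int n = j] (mod int p) \<longleftrightarrow> [n = a] (mod p)" for n
    unfolding cong_int_iff[symmetric] a_int by (simp add: Cong.cong_def)
  have a_dvd: "p dvd a \<longleftrightarrow> int p dvd j"
  proof -
    have "p dvd a \<longleftrightarrow> int p dvd int a" by simp
    also have "\<dots> \<longleftrightarrow> int p dvd j" unfolding a_int by (simp add: dvd_mod_iff)
    finally show ?thesis .
  qed
  define l where "l = (if int p dvd j then 0 else 1 / real (p - 1))"
  have "\<exists>B. \<forall>X. \<bar>prime_weight (\<lambda>n. [n = a] (mod p)) X - l * ?V X\<bar> \<le> B"
  proof (cases "int p dvd j")
    case True
    then have "[n = a] (mod p) \<longleftrightarrow> p dvd n" for n
      using a_dvd by (simp add: Cong.cong_def mod_eq_0_iff_dvd)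
    then show ?thesis using True prime_weight_multiples_le[OF p] mangoldt_weight_nonneg
      by (intro exI[of _ "mangoldt p / real p"]) (auto simp: l_def)
  next
    case False
    then obtain B where B: "\<And>X. \<bar>real (p - 1) * prime_weight (\<lambda>n. [n = a] (mod p)) X - ?V X\<bar> \<le> B"
      using prime_weight_equidistributed[OF p, of a] a_dvd by blast
    have "\<bar>prime_weight (\<lambda>n. [n = a] (mod p)) X - l * ?V X\<bar> \<le> B / real (p - 1)" for X
    proof -
      have "prime_weight (\<lambda>n. [n = a] (mod p)) X - l * ?V X
          = (real (p - 1) * prime_weight (\<lambda>n. [n = a] (mod p)) X - ?V X) / real (p - 1)"
        using False p1 by (simp add: l_def field_simps)
      then show ?thesis using B[of X] p1 by (simp add: divide_right_mono)
    qed
    then show ?thesis by blast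
  qed
  then obtain B where B: "\<And>X. \<bar>prime_weight (\<lambda>n. [n = a] (mod p)) X - l * ?V X\<bar> \<le> B" by blast
  have "(\<lambda>X. prime_density X {z. [z = j] (mod int p)} - l) \<longlonglongrightarrow> 0"
  proof (rule Lim_null_comparison)
    show "(\<lambda>X. B / ?V X) \<longlonglongrightarrow> 0"
      by (intro real_tendsto_divide_at_top[OF tendsto_const] prime_weight_at_top)
    show "\<forall>\<^sub>F X in sequentially. norm (prime_density X {z. [z = j] (mod int p)} - l) \<le> B / ?V X"
      using eventually_ge_at_top[of 2]
    proof eventually_elim
      case (elim X)
      have pos: "?V X > 0" by (rule prime_weight_pos[OF elim])
      have "prime_density X {z. [z = j] (mod int p)} - l 
          = (prime_weight (\<lambda>n. [n = a] (mod p)) X - l * ?V X) / ?V X"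
        using pos by (simp add: prime_density_def mem diff_divide_distrib)
      then show ?case using B[of X] pos by (simp add: divide_right_mono)
    qed
  qed
  then show ?thesis using LIM_zero_iff l_def by blast
qed

text \<open>
  The averages of the two limit laws are \<open>(0 + 2/p) / 2\<close> at the class \<open>0\<close> and
  \<open>(1/(p-1) + (p-2)/(p(p-1))) / 2\<close> at any other class; both equal \<open>1/p\<close>.
\<close>

lemma PR_charge_with_half_primes: "\<exists>\<mu>\<in>PR. \<mu> primes_int = 1 / 2"
proof -
  obtain Q :: "nat \<Rightarrow> int pmf" where Q: "\<And>n. set_pmf (Q n) \<subseteq> {..<0}"
    "\<And>p j. prime p \<Longrightarrow> (\<lambda>n. measure_pmf.prob (Q n) {z. [z = j] (mod int p)}) 
        \<longlonglongrightarrow> measure_pmf.prob (compensating_law p) {z. [z = j] (mod int p)}"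
    using negative_pmfs_with_limit_laws[of compensating_law] by blast
  \<comment> \<open>the shift by \<open>2\<close> ensures that there is a prime up to the bound, so that \<open>prime_density\<close> is a probability\<close>
  define m where "m n A = 1 / 2 * prime_density (n + 2) A + (1 - 1 / 2) * measure_pmf.prob (Q n) A" for n A
  have "probability_charge (m n)" for n
    unfolding m_def
    by (intro probability_charge_convex probability_charge_prime_density probability_charge_pmf) auto
  then obtain \<mu> where \<mu>: "probability_charge \<mu>" "\<And>A c. (\<lambda>n. m n A) \<longlonglongrightarrow> c \<Longrightarrow> \<mu> A = c"
    using limit_charge_exists by blast
  have "\<mu> {z. [z = j] (mod int p)} = 1 / real p" if p: "prime p" for p j
  proof -
    have p1: "p > 1" using p by (rule prime_gt_1_nat)
    have "(\<lambda>n. m n {z. [z = j] (mod int p)}) \<longlonglongrightarrow> 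
       1 / 2 * (if int p dvd j then 0 else 1 / real (p - 1)) + 
       (1 - 1 / 2) * measure_pmf.prob (compensating_law p) {z. [z = j] (mod int p)}"
      unfolding m_def
      by (intro tendsto_intros Q(2)[OF p] LIMSEQ_ignore_initial_segment[OF prime_density_residue_class_tendsto[OF p]])
    also have "1 / 2 * (if int p dvd j then 0 else 1 / real (p - 1)) + 
       (1 - 1 / 2) * measure_pmf.prob (compensating_law p) {z. [z = j] (mod int p)} = 1 / real p"
    proof -
      have "1 / real (p - 1) = real p / (real p * real (p - 1))" using p1 by simp
      then have "1 / real (p - 1) + real (p - 2) / (real p * real (p - 1)) 
          = (real p + real (p - 2)) / (real p * real (p - 1))" by (simp only: add_divide_distrib)
      also have "real p + real (p - 2) = 2 * real (p - 1)" using p1 by simp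
      also have "2 * real (p - 1) / (real p * real (p - 1)) = 2 / real p"
        using p1 by (intro mult_divide_mult_cancel_right) simp
      finally have "1 / real (p - 1) + real (p - 2) / (real p * real (p - 1)) = 2 / real p" .
      moreover have "1 / 2 * a + (1 - 1 / 2) * b = 1 / real p" if "a + b = 2 / real p" for a b :: real
      proof -
        have "1 / 2 * a + (1 - 1 / 2) * b = (a + b) / 2" by (simp add: field_simps)
        then show ?thesis using that by simp
      qed
      ultimately have mean: "1 / 2 * (1 / real (p - 1)) + (1 - 1 / 2) * (real (p - 2) / (real p * real (p - 1))) 
          = 1 / real p" by blast
      show ?thesis
      proof (cases "int p dvd j")
        case False
        then show ?thesis using mean by (simp only: prob_compensating_law[OF p1] if_False)
      qed (simp add: prob_compensating_law[OF p1])
    qed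
    finally show ?thesis by (rule \<mu>(2))
  qed
  moreover have "\<mu> primes_int = 1 / 2"
    by (rule \<mu>(2)) (simp add: m_def prime_density_primes_int prob_primes_int_eq_0[OF Q(1)])
  ultimately show ?thesis using PR_I[OF \<mu>(1)] by blast
qed

lemma PR_convex:
  assumes "\<mu> \<in> PR" "\<nu> \<in> PR" "0 \<le> t" "t \<le> 1"
  shows "(\<lambda>A. t * \<mu> A + (1 - t) * \<nu> A) \<in> PR"
  unfolding PR_def
proof (intro CollectI conjI allI impI)
  show "probability_charge (\<lambda>A. t * \<mu> A + (1 - t) * \<nu> A)"
    using assms by (intro probability_charge_convex) (auto simp: PR_def)
  fix p j :: int assume "prime p"
  then have "\<mu> {z. [z = j] (mod p)} = 1 / of_int p" "\<nu> {z. [z = j] (mod p)} = 1 / of_int p"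
    using assms by (auto simp: PR_def)
  then show "t * \<mu> {z. [z = j] (mod p)} + (1 - t) * \<nu> {z. [z = j] (mod p)} = 1 / of_int p"
    by (simp only: distrib_right[symmetric]) simp
qed

lemma charge_mono:
  assumes "probability_charge \<mu>" "A \<subseteq> B"
  shows "\<mu> A \<le> \<mu> B"
proof -
  have "A \<union> (B - A) = B" "A \<inter> (B - A) = {}" using assms(2) by auto
  then have "\<mu> B = \<mu> A + \<mu> (B - A)" "\<mu> (B - A) \<ge> 0"
    using assms(1) unfolding probability_charge_def by metis+
  then show ?thesis by simp
qed

lemma PR_singleton_eq_0:
  assumes "\<mu> \<in> PR"
  shows "\<mu> {x} = 0"
proof (rule ccontr)
  assume "\<mu> {x} \<noteq> 0"
  have ch: "probability_charge \<mu>" using assms by (simp add: PR_def)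
  then have pos: "\<mu> {x} > 0" using \<open>\<mu> {x} \<noteq> 0\<close> by (simp add: probability_charge_def order_less_le)
  obtain n :: nat where n: "real n > 1 / \<mu> {x}" using reals_Archimedean2 by blast
  obtain p where p: "prime p" "p > n" using bigger_prime by blast
  have "\<mu> {x} \<le> \<mu> {z. [z = x] (mod int p)}" by (intro charge_mono[OF ch]) auto
  also have "\<dots> = 1 / real p" using assms p(1) by (simp add: PR_def)
  also have "\<dots> < \<mu> {x}"
  proof -
    have "1 / \<mu> {x} < real p" using n p(2) by simp
    then show ?thesis using pos p(2) by (simp add: field_simps)
  qed
  finally show False by simp
qed

lemma PR_primes_le_half:
  assumes "\<mu> \<in> PR"
  shows "\<mu> primes_int \<le> 1 / 2"
proof -
  have ch: "probability_charge \<mu>" using assms by (simp add: PR_def)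
  have "primes_int \<subseteq> {2} \<union> {z. [z = 1] (mod 2)}"
  proof
    fix q assume "q \<in> primes_int"
    then have q: "prime q" by (simp add: primes_int_def)
    show "q \<in> {2} \<union> {z. [z = 1] (mod 2)}"
    proof (cases "q = 2")
      case False
      then have "odd q" using q primes_dvd_imp_eq[of 2 q] by auto
      then show ?thesis by (simp add: Cong.cong_def odd_iff_mod_2_eq_one)
    qed simp
  qed
  then have "\<mu> primes_int \<le> \<mu> ({2} \<union> {z. [z = 1] (mod 2)})" by (rule charge_mono[OF ch])
  also have "\<dots> = \<mu> {2} + \<mu> {z. [z = 1] (mod 2)}"
  proof -
    have "{2} \<inter> {z :: int. [z = 1] (mod 2)} = {}" by (auto simp: Cong.cong_def)
    then show ?thesis using ch unfolding probability_charge_def by blast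
  qed
  also have "\<mu> {2} = 0" by (rule PR_singleton_eq_0[OF assms])
  also have "\<mu> {z. [z = 1] (mod 2)} = 1 / 2"
  proof -
    have "\<mu> {z. [z = j] (mod p)} = 1 / of_int p" if "prime p" for p j
      using assms that by (simp add: PR_def)
    from this[of 2 1] show ?thesis by simp
  qed
  finally show ?thesis by simp
qed

text \<open>
  The value \<open>x\<close> is attained by the mixture with weight \<open>2 x\<close> on a charge of value \<open>1/2\<close> and
  weight \<open>1 - 2 x\<close> on a charge of value \<open>0\<close>.
\<close>

theorem theorem4:
  shows "{\<mu> primes_int | \<mu>. \<mu> \<in> PR} = {0..1/2}"
proof (intro equalityI subsetI)
  fix x assume "x \<in> {\<mu> primes_int | \<mu>. \<mu> \<in> PR}"
  then show "x \<in> {0..1/2}"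
    using PR_primes_le_half by (auto simp: PR_def probability_charge_def)
next
  fix x :: real assume x: "x \<in> {0..1/2}"
  obtain \<mu> where \<mu>: "\<mu> \<in> PR" "\<mu> primes_int = 1 / 2"
    using PR_charge_with_half_primes by blast
  obtain \<nu> where \<nu>: "\<nu> \<in> PR" "\<nu> primes_int = 0"
    using PR_charge_without_primes by blast
  let ?\<kappa> = "\<lambda>A. 2 * x * \<mu> A + (1 - 2 * x) * \<nu> A"
  have "?\<kappa> \<in> PR" using x by (intro PR_convex \<mu> \<nu>) auto
  moreover have "?\<kappa> primes_int = x" by (simp add: \<mu> \<nu>)
  ultimately show "x \<in> {\<mu> primes_int | \<mu>. \<mu> \<in> PR}" by (intro CollectI exI[of _ ?\<kappa>]) simp
qed

end
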